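(* For any constant $k$, there is an algorithm for testing whether a distribution on $\{-1,1\}^n$ is fully uniform or $\delta$-far from every $k$-wise uniform distribution, with sample complexity $O(k)^k\cdot n^{k/2}\cdot\frac{1}{\delta^2}\cdot\left(\log\frac{n}{\delta}\right)^{k/2}$. Moreover, for any $\alpha>4$, there is an algorithm for testing whether a distribution is $\alpha k$-wise uniform or $\delta$-far from $k$-wise uniform, with sample complexity $O(\alpha)^{k/2}\cdot n^{k/2}\cdot\frac{1}{\delta^2}\cdot\left(\frac{n^k}{\delta^4}\right)^{1/(\alpha-2)}$.
   Context: Distributions on $\{-1,1\}^n$ are identified with densities $\varphi:\{-1,1\}^n\to\mathbb{R}^{\ge0}$ with $\mathbb{E}_{x\sim\{-1,1\}^n}[\varphi(x)]=1$, $\Pr[x]=\varphi(x)/2^n$; $\widehat\varphi(S)=\mathbb{E}_{x\sim\{-1,1\}^n}[\varphi(x)\prod_{i\in S}x_i]$. $\varphi$ is $j$-wise uniform iff $\widehat\varphi(S)=0$ for all $1\le|S|\le j$; fully uniform means $\varphi\equiv1$. $\varphi$ is $\delta$-far from $k$-wise uniform if its total variation distance $\frac12\mathbb{E}_x|\varphi(x)-\psi(x)|$ to every $k$-wise uniform density $\psi$ exceeds $\delta$. A testing algorithm receives i.i.d. samples from the unknown distribution and must output "Yes" with probability at least $2/3$ in the first case and "No" with probability at least $2/3$ in the second case. *)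

theory Defs
  imports "HOL-Probability.Probability"
begin

text \<open>Points of \<open>{-1,1}^n\<close> are extensional functions on \<open>{..<n}\<close>, since \<open>n\<close> varies
  inside the statements.\<close>

type_synonym point = "nat \<Rightarrow> real"

definition cube :: "nat \<Rightarrow> point set" where
  "cube n = {..<n} \<rightarrow>\<^sub>E {-1, 1}"

definition unif_expect :: "nat \<Rightarrow> (point \<Rightarrow> real) \<Rightarrow> real" where
  "unif_expect n f = measure_pmf.expectation (pmf_of_set (cube n)) f"

definition is_density :: "nat \<Rightarrow> (point \<Rightarrow> real) \<Rightarrow> bool" where
  "is_density n \<phi> \<longleftrightarrow> (\<forall>x\<in>cube n. \<phi> x \<ge> 0) \<and> unif_expect n \<phi> = 1"

text \<open>\<open>embed_pmf\<close> is only meaningful for a nonnegative function of total mass 1, which is the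
  case here exactly when \<open>is_density n \<phi>\<close> holds.\<close>

definition density_pmf :: "nat \<Rightarrow> (point \<Rightarrow> real) \<Rightarrow> point pmf" where
  "density_pmf n \<phi> = embed_pmf (\<lambda>x. if x \<in> cube n then \<phi> x / 2 ^ n else 0)"

definition fourier_coeff :: "nat \<Rightarrow> (point \<Rightarrow> real) \<Rightarrow> nat set \<Rightarrow> real" where
  "fourier_coeff n \<phi> S = unif_expect n (\<lambda>x. \<phi> x * (\<Prod>i\<in>S. x i))"

text \<open>The order \<open>j\<close> is real, so that \<open>\<alpha> k\<close>-wise uniformity makes sense for real \<open>\<alpha>\<close>; it then
  coincides with uniformity of order \<open>\<lfloor>\<alpha> k\<rfloor>\<close>.\<close>

definition wise_uniform :: "nat \<Rightarrow> real \<Rightarrow> (point \<Rightarrow> real) \<Rightarrow> bool" where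
  "wise_uniform n j \<phi> \<longleftrightarrow>
     (\<forall>S. S \<subseteq> {..<n} \<and> 1 \<le> card S \<and> real (card S) \<le> j \<longrightarrow> fourier_coeff n \<phi> S = 0)"

definition fully_uniform :: "nat \<Rightarrow> (point \<Rightarrow> real) \<Rightarrow> bool" where
  "fully_uniform n \<phi> \<longleftrightarrow> (\<forall>x\<in>cube n. \<phi> x = 1)"

definition tv_dist :: "nat \<Rightarrow> (point \<Rightarrow> real) \<Rightarrow> (point \<Rightarrow> real) \<Rightarrow> real" where
  "tv_dist n \<phi> \<psi> = 1 / 2 * unif_expect n (\<lambda>x. \<bar>\<phi> x - \<psi> x\<bar>)"

definition far_from_wise_uniform :: "nat \<Rightarrow> real \<Rightarrow> real \<Rightarrow> (point \<Rightarrow> real) \<Rightarrow> bool" where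
  "far_from_wise_uniform n \<delta> j \<phi> \<longleftrightarrow>
     (\<forall>\<psi>. is_density n \<psi> \<and> wise_uniform n j \<psi> \<longrightarrow> tv_dist n \<phi> \<psi> > \<delta>)"

text \<open>A testing algorithm maps the list of samples to a random answer, \<open>True\<close> meaning ``Yes''.
  Its output distribution below accounts for both the samples and the internal coins.\<close>

type_synonym tester = "point list \<Rightarrow> bool pmf"

definition output_pmf :: "nat \<Rightarrow> nat \<Rightarrow> tester \<Rightarrow> (point \<Rightarrow> real) \<Rightarrow> bool pmf" where
  "output_pmf n m A \<phi> = bind_pmf (replicate_pmf m (density_pmf n \<phi>)) A"

definition tests ::
  "nat \<Rightarrow> nat \<Rightarrow> tester \<Rightarrow> ((point \<Rightarrow> real) \<Rightarrow> bool) \<Rightarrow> ((point \<Rightarrow> real) \<Rightarrow> bool) \<Rightarrow> bool" where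
  "tests n m A P Q \<longleftrightarrow>
     (\<forall>\<phi>. is_density n \<phi> \<longrightarrow>
        (P \<phi> \<longrightarrow> pmf (output_pmf n m A \<phi>) True \<ge> 2 / 3) \<and>
        (Q \<phi> \<longrightarrow> pmf (output_pmf n m A \<phi>) False \<ge> 2 / 3))"

end

theory Submission
  imports Defs
begin

text \<open>
  A single tester, using \<open>C^k n^(k/2) / \<delta>\<^sup>2\<close> samples, separates \<open>4k\<close>-wise uniform densities from those
  that are \<open>\<delta>\<close>-far from \<open>k\<close>-wise uniform, and both claims follow from it. Let
  \<open>K x y = \<Sum> chi S x * chi S y\<close>, the sum ranging over the \<open>N\<close> sets \<open>S\<close> with \<open>1 \<le> card S \<le> k\<close>, and draw
  independent samples \<open>x\<^sub>i\<close>, \<open>y\<^sub>j\<close>, \<open>m\<close> of each. One accepts if \<open>\<bar>K x\<^sub>i y\<^sub>j\<bar> \<le> t\<close> for all \<open>i\<close>, \<open>j\<close>, where \<open>t\<^sup>2\<close>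
  has order \<open>m N\<close>, if the sum of the \<open>(K x\<^sub>i y\<^sub>j)\<^sup>2\<close> is \<open>O(m\<^sup>2 N)\<close>, and if the sum of the \<open>K x\<^sub>i y\<^sub>j\<close> is small.

  Under \<open>4k\<close>-wise uniformity the first four moments of \<open>K\<close> are those of the uniform case, so acceptance
  follows from Markov's inequality and Bonami's bound on fourth moments. For a far density the mean
  of \<open>K\<close> is the Fourier weight \<open>W\<close> on levels \<open>1..k\<close>, which is at least \<open>c^k \<delta>\<^sup>2\<close>: by truncating polynomials
  and iterating, any prescribed coefficients on levels \<open>\<le> k\<close> are realised by a function bounded by
  \<open>5 * 3^k\<close> times their \<open>L\<^sup>2\<close> norm, and adding it repairs the density. The sum of the \<open>K x\<^sub>i y\<^sub>j\<close> need not
  concentrate, but if it does not, then one of the other two checks fails with constant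
  probability. Repeating the test 20 times amplifies this.
\<close>

subsection \<open>Moments of sums over independent samples\<close>

text \<open>Finite support makes every function integrable and turns expectations into finite sums;
  distributions on the cube satisfy it.\<close>

lemma expectation_bind_finite:
  fixes h :: "'b \<Rightarrow> real"
  assumes "finite (set_pmf p)" "\<And>x. x \<in> set_pmf p \<Longrightarrow> finite (set_pmf (f x))"
  shows "measure_pmf.expectation (bind_pmf p f) h =
    measure_pmf.expectation p (\<lambda>x. measure_pmf.expectation (f x) h)"
  by (subst pmf_expectation_bind[OF assms(1)])
     (use assms in \<open>auto simp: integral_measure_pmf_real[OF assms(1)] mult.commute intro!: sum.cong\<close>)

lemma expectation_mono_finite:
  fixes f g :: "'a \<Rightarrow> real"
  assumes "finite (set_pmf p)" "\<And>x. x \<in> set_pmf p \<Longrightarrow> f x \<le> g x"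
  shows "measure_pmf.expectation p f \<le> measure_pmf.expectation p g"
  using assms by (intro integral_mono_AE integrable_measure_pmf_finite) (auto simp: AE_measure_pmf_iff)

lemma expectation_cong_pmf:
  assumes "\<And>x. x \<in> set_pmf p \<Longrightarrow> f x = g x"
  shows "measure_pmf.expectation p f = measure_pmf.expectation p g"
  by (intro Bochner_Integration.integral_cong_AE) (use assms in \<open>auto simp: AE_measure_pmf_iff\<close>)

lemma prob_eq_expectation:
  "measure_pmf.prob p A = measure_pmf.expectation p (\<lambda>x. of_bool (x \<in> A))"
proof -
  have "(\<lambda>x. of_bool (x \<in> A) :: real) = indicator A" by (auto simp: indicator_def)
  thus ?thesis by simp
qed

lemma expectation_commute:
  fixes f :: "'a \<Rightarrow> 'b \<Rightarrow> real"
  assumes "finite (set_pmf p)" "finite (set_pmf q)"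
  shows "measure_pmf.expectation p (\<lambda>x. measure_pmf.expectation q (\<lambda>y. f x y)) =
    measure_pmf.expectation q (\<lambda>y. measure_pmf.expectation p (\<lambda>x. f x y))"
  by (simp add: integral_measure_pmf_real[OF assms(1)] integral_measure_pmf_real[OF assms(2)]
      sum_distrib_right sum_distrib_left sum.swap[of _ "set_pmf p"] mult_ac)

lemma finite_replicate_pmf [simp]: "finite (set_pmf p) \<Longrightarrow> finite (set_pmf (replicate_pmf m p))"
  using finite_lists_length_eq[of "set_pmf p" m] by (simp add: set_replicate_pmf in_lists_conv_set subset_eq)

lemma expectation_replicate_Suc:
  fixes h :: "'a list \<Rightarrow> real"
  assumes "finite (set_pmf p)"
  shows "measure_pmf.expectation (replicate_pmf (Suc m) p) h =
    measure_pmf.expectation p (\<lambda>x. measure_pmf.expectation (replicate_pmf m p) (\<lambda>xs. h (x # xs)))"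
  using assms by (simp add: expectation_bind_finite)

lemma expectation_sum_list:
  fixes f :: "'a \<Rightarrow> real"
  assumes fin: "finite (set_pmf p)"
  shows "measure_pmf.expectation (replicate_pmf m p) (\<lambda>xs. \<Sum>x\<leftarrow>xs. f x) = m * measure_pmf.expectation p f"
proof (induction m)
  case (Suc m)
  note [simp] = integrable_measure_pmf_finite[OF fin]
    integrable_measure_pmf_finite[OF finite_replicate_pmf[OF fin]]
  show ?case using Suc
    by (subst expectation_replicate_Suc[OF fin]) (simp add: algebra_simps del: replicate_pmf.simps)
qed simp

text \<open>Of the \<open>m * m\<close> ordered pairs of positions, \<open>m\<close> are diagonal
  and the others consist of independent samples. The difference \<open>real m - 1\<close> is real,
  which is harmless at \<open>m = 0\<close> because of the factor \<open>m\<close>.\<close>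

lemma expectation_sum_list_square:
  fixes f :: "'a \<Rightarrow> real"
  assumes fin: "finite (set_pmf p)"
  shows "measure_pmf.expectation (replicate_pmf m p) (\<lambda>xs. (\<Sum>x\<leftarrow>xs. f x)\<^sup>2) =
    m * measure_pmf.expectation p (\<lambda>x. (f x)\<^sup>2) + m * (real m - 1) * (measure_pmf.expectation p f)\<^sup>2"
proof (induction m)
  case (Suc m)
  note [simp] = integrable_measure_pmf_finite[OF fin]
    integrable_measure_pmf_finite[OF finite_replicate_pmf[OF fin]]
  have "measure_pmf.expectation (replicate_pmf (Suc m) p) (\<lambda>xs. (\<Sum>x\<leftarrow>xs. f x)\<^sup>2) =
    measure_pmf.expectation p (\<lambda>x. measure_pmf.expectation (replicate_pmf m p)
       (\<lambda>xs. (f x)\<^sup>2 + 2 * f x * (\<Sum>x\<leftarrow>xs. f x) + (\<Sum>x\<leftarrow>xs. f x)\<^sup>2))"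
    by (subst expectation_replicate_Suc[OF fin]) (simp add: power2_eq_square algebra_simps del: replicate_pmf.simps)
  also have "\<dots> = measure_pmf.expectation p (\<lambda>x. (f x)\<^sup>2 + 2 * (m * measure_pmf.expectation p f) * f x +
     (m * measure_pmf.expectation p (\<lambda>x. (f x)\<^sup>2) + m * (real m - 1) * (measure_pmf.expectation p f)\<^sup>2))"
    using Suc by (simp add: expectation_sum_list[OF fin] mult_ac)
  also have "\<dots> = measure_pmf.expectation p (\<lambda>x. (f x)\<^sup>2) + 2 * (m * measure_pmf.expectation p f) * measure_pmf.expectation p f +
     (m * measure_pmf.expectation p (\<lambda>x. (f x)\<^sup>2) + m * (real m - 1) * (measure_pmf.expectation p f)\<^sup>2)"
    by simp
  also have "\<dots> = Suc m * measure_pmf.expectation p (\<lambda>x. (f x)\<^sup>2)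
      + Suc m * (real (Suc m) - 1) * (measure_pmf.expectation p f)\<^sup>2"
    by (simp add: algebra_simps power2_eq_square)
  finally show ?case .
qed simp

lemma prob_list_all:
  assumes fin: "finite (set_pmf p)"
  shows "measure_pmf.prob (replicate_pmf m p) {xs. \<forall>x\<in>set xs. P x} = measure_pmf.prob p {x. P x} ^ m"
proof (induction m)
  case (Suc m)
  note [simp] = integrable_measure_pmf_finite[OF fin]
    integrable_measure_pmf_finite[OF finite_replicate_pmf[OF fin]]
  have "measure_pmf.prob (replicate_pmf (Suc m) p) {xs. \<forall>x\<in>set xs. P x} =
     measure_pmf.expectation p (\<lambda>x. measure_pmf.expectation (replicate_pmf m p)
       (\<lambda>xs. of_bool (P x) * of_bool (\<forall>x\<in>set xs. P x)))"
    unfolding prob_eq_expectation by (subst expectation_replicate_Suc[OF fin]) (simp add: of_bool_conj)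
  also have "\<dots> = measure_pmf.expectation p (\<lambda>x. of_bool (P x)) *
      measure_pmf.expectation (replicate_pmf m p) (\<lambda>xs. of_bool (\<forall>x\<in>set xs. P x))"
    by (simp only: integral_mult_right_zero integral_mult_left_zero)
  finally show ?case using Suc unfolding prob_eq_expectation by (simp del: replicate_pmf.simps)
qed simp

section \<open>Double sums over two independent samples\<close>

text \<open>Two separate lists ensure that the kernel is only ever evaluated at independent points,
  so no diagonal terms \<open>K x x\<close> arise.\<close>

definition sample_pair :: "nat \<Rightarrow> 'a pmf \<Rightarrow> ('a list \<times> 'a list) pmf" where
  "sample_pair m p = pair_pmf (replicate_pmf m p) (replicate_pmf m p)"

lemma finite_sample_pair: "finite (set_pmf p) \<Longrightarrow> finite (set_pmf (sample_pair m p))"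
  by (simp add: sample_pair_def)

lemma expectation_sample_pair:
  fixes h :: "_ \<Rightarrow> real"
  assumes fin: "finite (set_pmf p)"
  shows "measure_pmf.expectation (sample_pair m p) h =
    measure_pmf.expectation (replicate_pmf m p) (\<lambda>xs. measure_pmf.expectation (replicate_pmf m p) (\<lambda>ys. h (xs, ys)))"
  unfolding sample_pair_def pair_pmf_def using fin by (simp add: expectation_bind_finite)

definition pair_sum :: "('a \<Rightarrow> 'a \<Rightarrow> real) \<Rightarrow> 'a list \<times> 'a list \<Rightarrow> real" where
  "pair_sum F z = (\<Sum>x\<leftarrow>fst z. \<Sum>y\<leftarrow>snd z. F x y)"

lemma pair_sum_commute: "pair_sum F (xs, ys) = (\<Sum>y\<leftarrow>ys. \<Sum>x\<leftarrow>xs. F x y)"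
  by (induction xs) (simp_all add: pair_sum_def sum_list_addf)

lemma pair_sum_mono:
  "(\<And>x y. x \<in> set (fst z) \<Longrightarrow> y \<in> set (snd z) \<Longrightarrow> F x y \<le> G x y) \<Longrightarrow> pair_sum F z \<le> pair_sum G z"
  unfolding pair_sum_def by (intro sum_list_mono) auto

lemma expectation_pair_sum:
  assumes fin: "finite (set_pmf p)"
  shows "measure_pmf.expectation (sample_pair m p) (pair_sum F) =
    m\<^sup>2 * measure_pmf.expectation p (\<lambda>x. measure_pmf.expectation p (F x))"
proof -
  note [simp] = integrable_measure_pmf_finite[OF fin]
    integrable_measure_pmf_finite[OF finite_replicate_pmf[OF fin]]
  have "measure_pmf.expectation (sample_pair m p) (pair_sum F) =
    measure_pmf.expectation (replicate_pmf m p) (\<lambda>xs. measure_pmf.expectation (replicate_pmf m p) (\<lambda>ys. \<Sum>y\<leftarrow>ys. \<Sum>x\<leftarrow>xs. F x y))"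
    by (simp add: expectation_sample_pair[OF fin] pair_sum_commute)
  also have "\<dots> = m * measure_pmf.expectation p (\<lambda>y. measure_pmf.expectation (replicate_pmf m p) (\<lambda>xs. \<Sum>x\<leftarrow>xs. F x y))"
    by (simp add: expectation_sum_list[OF fin]
        expectation_commute[OF finite_replicate_pmf[OF fin] fin, of m "\<lambda>xs y. \<Sum>x\<leftarrow>xs. F x y"])
  also have "\<dots> = m * (m * measure_pmf.expectation p (\<lambda>x. measure_pmf.expectation p (F x)))"
    by (simp add: expectation_sum_list[OF fin] expectation_commute[OF fin fin, of "\<lambda>x y. F y x"])
  finally show ?thesis by (simp add: power2_eq_square)
qed

text \<open>Two index pairs may agree in both coordinates, in the first only, in the second only, or
  in neither. These four kinds number \<open>m^2\<close>, \<open>m^2 * (m - 1)\<close>,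
  \<open>m^2 * (m - 1)\<close> and \<open>m^2 * (m - 1)^2\<close> and give the four terms.\<close>

lemma expectation_pair_sum_square:
  fixes F :: "'a \<Rightarrow> 'a \<Rightarrow> real"
  assumes fin: "finite (set_pmf p)"
  defines "E \<equiv> measure_pmf.expectation p"
  shows "measure_pmf.expectation (sample_pair m p) (\<lambda>z. (pair_sum F z)\<^sup>2) =
    m\<^sup>2 * E (\<lambda>x. E (\<lambda>y. (F x y)\<^sup>2)) + m\<^sup>2 * (real m - 1) * (E (\<lambda>x. (E (F x))\<^sup>2) + E (\<lambda>y. (E (\<lambda>x. F x y))\<^sup>2))
     + m\<^sup>2 * (real m - 1)\<^sup>2 * (E (\<lambda>x. E (F x)))\<^sup>2"
proof -
  note [simp] = integrable_measure_pmf_finite[OF fin]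
    integrable_measure_pmf_finite[OF finite_replicate_pmf[OF fin]]
  let ?R = "measure_pmf.expectation (replicate_pmf m p)"
  have "measure_pmf.expectation (sample_pair m p) (\<lambda>z. (pair_sum F z)\<^sup>2) =
    ?R (\<lambda>xs. ?R (\<lambda>ys. (\<Sum>y\<leftarrow>ys. \<Sum>x\<leftarrow>xs. F x y)\<^sup>2))"
    by (simp add: expectation_sample_pair[OF fin] pair_sum_commute)
  also have "\<dots> = ?R (\<lambda>xs. m * E (\<lambda>y. (\<Sum>x\<leftarrow>xs. F x y)\<^sup>2) + m * (real m - 1) * (E (\<lambda>y. \<Sum>x\<leftarrow>xs. F x y))\<^sup>2)"
    by (simp add: expectation_sum_list_square[OF fin] E_def)
  also have "(\<lambda>xs. E (\<lambda>y. \<Sum>x\<leftarrow>xs. F x y)) = (\<lambda>xs. \<Sum>x\<leftarrow>xs. E (F x))"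
  proof
    fix xs show "E (\<lambda>y. \<Sum>x\<leftarrow>xs. F x y) = (\<Sum>x\<leftarrow>xs. E (F x))"
      by (induction xs) (simp_all add: E_def)
  qed
  hence "?R (\<lambda>xs. m * E (\<lambda>y. (\<Sum>x\<leftarrow>xs. F x y)\<^sup>2) + m * (real m - 1) * (E (\<lambda>y. \<Sum>x\<leftarrow>xs. F x y))\<^sup>2)
     = m * ?R (\<lambda>xs. E (\<lambda>y. (\<Sum>x\<leftarrow>xs. F x y)\<^sup>2)) + m * (real m - 1) * ?R (\<lambda>xs. (\<Sum>x\<leftarrow>xs. E (F x))\<^sup>2)"
    by (simp add: fun_eq_iff)
  also have "?R (\<lambda>xs. E (\<lambda>y. (\<Sum>x\<leftarrow>xs. F x y)\<^sup>2)) = E (\<lambda>y. ?R (\<lambda>xs. (\<Sum>x\<leftarrow>xs. F x y)\<^sup>2))"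
    unfolding E_def by (rule expectation_commute[OF finite_replicate_pmf[OF fin] fin])
  also have "\<dots> = m * E (\<lambda>y. E (\<lambda>x. (F x y)\<^sup>2)) + m * (real m - 1) * E (\<lambda>y. (E (\<lambda>x. F x y))\<^sup>2)"
    by (simp add: expectation_sum_list_square[OF fin] E_def)
  also have "E (\<lambda>y. E (\<lambda>x. (F x y)\<^sup>2)) = E (\<lambda>x. E (\<lambda>y. (F x y)\<^sup>2))"
    unfolding E_def by (rule expectation_commute[OF fin fin])
  also have "?R (\<lambda>xs. (\<Sum>x\<leftarrow>xs. E (F x))\<^sup>2) = m * E (\<lambda>x. (E (F x))\<^sup>2) + m * (real m - 1) * (E (\<lambda>x. E (F x)))\<^sup>2"
    by (simp add: expectation_sum_list_square[OF fin] E_def)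
  finally show ?thesis by (simp add: power2_eq_square algebra_simps)
qed

lemma markov_expectation:
  fixes X :: "'a \<Rightarrow> real"
  assumes "finite (set_pmf p)" "c > 0" "\<And>z. z \<in> set_pmf p \<Longrightarrow> 0 \<le> X z" "\<And>z. z \<in> set_pmf p \<Longrightarrow> P z \<Longrightarrow> c \<le> X z"
  shows "measure_pmf.prob p {z. P z} \<le> measure_pmf.expectation p X / c"
proof -
  have "measure_pmf.prob p {z. P z} \<le> measure_pmf.expectation p (\<lambda>z. X z / c)"
    unfolding prob_eq_expectation using assms(2-)
    by (intro expectation_mono_finite assms(1)) (auto simp: of_bool_def field_simps)
  thus ?thesis by simp
qed

text \<open>Chebyshev's inequality at a deviation of half the mean, whence the factor 4. By
  symmetry, pairs sharing a row and pairs sharing a column contribute equally; the remaining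
  multiple of \<open>a\<^sup>2\<close> in the variance is nonpositive and is dropped.\<close>

lemma pair_sum_lower_tail:
  fixes F :: "'a \<Rightarrow> 'a \<Rightarrow> real"
  assumes fin: "finite (set_pmf p)" and m: "m \<ge> 1"
  defines "E \<equiv> measure_pmf.expectation p"
  defines "a \<equiv> E (\<lambda>x. E (F x))"
  assumes a: "a > 0" and sym: "\<And>x y. F x y = F y x"
  shows "measure_pmf.prob (sample_pair m p) {z. pair_sum F z \<le> m\<^sup>2 * a / 2}
    \<le> 4 * (E (\<lambda>x. E (\<lambda>y. (F x y)\<^sup>2)) / m\<^sup>2 + 2 * E (\<lambda>x. (E (F x))\<^sup>2) / m) / a\<^sup>2"
proof -
  let ?M = "measure_pmf.expectation (sample_pair m p)"
  let ?V = "E (\<lambda>x. E (\<lambda>y. (F x y)\<^sup>2))" and ?U = "E (\<lambda>x. (E (F x))\<^sup>2)"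
  note fp = finite_sample_pair[OF fin, of m]
  note [simp] = integrable_measure_pmf_finite[OF fp]
  have U0: "?U \<ge> 0" unfolding E_def by (rule Bochner_Integration.integral_nonneg) simp
  have "measure_pmf.prob (sample_pair m p) {z. pair_sum F z \<le> m\<^sup>2 * a / 2}
     \<le> ?M (\<lambda>z. (pair_sum F z - m\<^sup>2 * a)\<^sup>2) / (m\<^sup>2 * a / 2)\<^sup>2"
  proof (rule markov_expectation[OF fp])
    show "0 < (m\<^sup>2 * a / 2)\<^sup>2" using m a by simp
    fix z assume "pair_sum F z \<le> m\<^sup>2 * a / 2"
    moreover have "m\<^sup>2 * a > 0" using m a by simp
    ultimately have "\<bar>m\<^sup>2 * a / 2\<bar> \<le> \<bar>pair_sum F z - m\<^sup>2 * a\<bar>" by linarith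
    thus "(m\<^sup>2 * a / 2)\<^sup>2 \<le> (pair_sum F z - m\<^sup>2 * a)\<^sup>2" by (simp only: abs_le_square_iff)
  qed simp
  also have "?M (\<lambda>z. (pair_sum F z - m\<^sup>2 * a)\<^sup>2) = ?M (\<lambda>z. (pair_sum F z)\<^sup>2 - 2 * (m\<^sup>2 * a) * pair_sum F z + (m\<^sup>2 * a)\<^sup>2)"
    by (simp add: power2_diff algebra_simps)
  also have "\<dots> = ?M (\<lambda>z. (pair_sum F z)\<^sup>2) - 2 * (m\<^sup>2 * a) * ?M (pair_sum F) + (m\<^sup>2 * a)\<^sup>2"
    by simp
  also have "\<dots> = m\<^sup>2 * ?V + 2 * m\<^sup>2 * (real m - 1) * ?U + (m\<^sup>2 * (real m - 1)\<^sup>2 - m ^ 4) * a\<^sup>2"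
    unfolding expectation_pair_sum[OF fin] expectation_pair_sum_square[OF fin] a_def[unfolded E_def, symmetric]
    by (simp add: E_def sym[of _ "_ :: 'a"] a_def power2_eq_square power4_eq_xxxx algebra_simps)
  also have "\<dots> \<le> m\<^sup>2 * ?V + 2 * m ^ 3 * ?U"
  proof -
    have "m\<^sup>2 * (real m - 1)\<^sup>2 \<le> m\<^sup>2 * (real m)\<^sup>2" using m by (intro mult_left_mono power_mono) auto
    hence "(m\<^sup>2 * (real m - 1)\<^sup>2 - m ^ 4) * a\<^sup>2 \<le> 0" by (intro mult_nonpos_nonneg) (auto simp flip: power_add)
    moreover have "2 * m\<^sup>2 * (real m - 1) * ?U \<le> 2 * m\<^sup>2 * (real m) * ?U"
      using U0 by (intro mult_right_mono mult_left_mono) auto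
    ultimately show ?thesis by (simp add: power2_eq_square power3_eq_cube)
  qed
  finally have "measure_pmf.prob (sample_pair m p) {z. pair_sum F z \<le> m\<^sup>2 * a / 2}
     \<le> (m\<^sup>2 * ?V + 2 * m ^ 3 * ?U) / (m\<^sup>2 * a / 2)\<^sup>2" by (simp add: divide_right_mono)
  also have "\<dots> = 4 * (?V / m\<^sup>2 + 2 * ?U / m) / a\<^sup>2"
    using m a by (simp add: field_simps power2_eq_square power3_eq_cube)
  finally show ?thesis by simp
qed

subsection \<open>The kernel test: completeness and amplification\<close>

text \<open>A rational substitute for the bound by exp(-x): multiply by
  \<open>(1 + x / m) ^ m\<close>, which is at least \<open>1 + x\<close> by Bernoulli, and use that
  \<open>(1 - x / m) * (1 + x / m)\<close> is at most 1.\<close>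

lemma power_one_minus_le:
  assumes "0 \<le> x" "x \<le> 1" "m \<ge> 1"
  shows "(1 - x / real m) ^ m \<le> 1 / (1 + x)"
proof -
  have xm: "x / m \<le> 1" "x / m \<ge> 0" using assms by auto
  have "1 + x \<le> (1 + x / m) ^ m"
    using Bernoulli_inequality[of "x / m" m] xm assms by simp
  moreover have "(1 - x / m) ^ m * (1 + x / m) ^ m \<le> 1"
    unfolding power_mult_distrib[symmetric]
  proof (rule power_le_one)
    have "(1 - x / m) * (1 + x / m) = 1 - (x / m) * (x / m)" by (simp add: algebra_simps)
    also have "\<dots> \<le> 1" using xm by (simp only: diff_le_eq le_add_same_cancel1) (rule mult_nonneg_nonneg)
    finally show "(1 - x / m) * (1 + x / m) \<le> 1" .
  qed (use xm in auto)
  moreover have "(1 - x / m) ^ m \<ge> 0" using xm by simp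
  ultimately have "(1 - x / m) ^ m * (1 + x) \<le> 1"
    by (meson mult_left_mono order_trans)
  thus ?thesis using assms by (simp add: field_simps)
qed

lemma prob_union_le:
  assumes "\<And>z. z \<in> set_pmf p \<Longrightarrow> P z \<Longrightarrow> Q z \<or> R z"
  shows "measure_pmf.prob p {z. P z} \<le> measure_pmf.prob p {z. Q z} + measure_pmf.prob p {z. R z}"
proof -
  have "measure_pmf.prob p {z. P z} = measure_pmf.prob p ({z. P z} \<inter> set_pmf p)"
    by (rule measure_Int_set_pmf[symmetric])
  also have "\<dots> \<le> measure_pmf.prob p ({z. Q z} \<union> {z. R z})"
    using assms by (intro measure_pmf.finite_measure_mono) auto
  also have "\<dots> \<le> measure_pmf.prob p {z. Q z} + measure_pmf.prob p {z. R z}"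
    by (rule measure_Un_le) auto
  finally show ?thesis .
qed

text \<open>The first list misses the well-connected points with probability at most 8/9. If it hits
  one, the second list misses the partners of that point with probability at most 1/2. Altogether
  1/2 + 1/2 * 8/9 = 17/18.\<close>

lemma prob_no_related_pair:
  fixes R :: "'a \<Rightarrow> 'a \<Rightarrow> bool"
  assumes fin: "finite (set_pmf p)" and m: "m \<ge> 1"
    and B: "1 / (8 * real m) \<le> measure_pmf.prob p {x. 1 / real m < measure_pmf.prob p {y. R x y}}"
  shows "measure_pmf.prob (sample_pair m p) {z. \<forall>x\<in>set (fst z). \<forall>y\<in>set (snd z). \<not> R x y} \<le> 17 / 18"
proof -
  define B where "B = {x. 1 / real m < measure_pmf.prob p {y. R x y}}"
  let ?M = "replicate_pmf m p"
  note [simp] = integrable_measure_pmf_finite[OF finite_replicate_pmf[OF fin]]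
  have compl: "measure_pmf.prob p {y. \<not> Q y} = 1 - measure_pmf.prob p {y. Q y}" for Q
    using measure_pmf.prob_compl[of "{y. Q y}" p] by (simp add: Compl_eq_Diff_UNIV[symmetric] Collect_neg_eq)
  have hit: "measure_pmf.prob ?M {ys. \<forall>y\<in>set ys. \<forall>x\<in>set xs. \<not> R x y} \<le> 1/2 + 1/2 * of_bool (\<forall>x\<in>set xs. x \<notin> B)" for xs
  proof (cases "\<forall>x\<in>set xs. x \<notin> B")
    case False
    then obtain x where x: "x \<in> set xs" "x \<in> B" by auto
    have "measure_pmf.prob ?M {ys. \<forall>y\<in>set ys. \<forall>x\<in>set xs. \<not> R x y} \<le> measure_pmf.prob ?M {ys. \<forall>y\<in>set ys. \<not> R x y}"
      using x by (intro measure_pmf.finite_measure_mono) auto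
    also have "\<dots> = (1 - measure_pmf.prob p {y. R x y}) ^ m"
      by (simp add: prob_list_all[OF fin] compl)
    also have "\<dots> \<le> (1 - 1 / m) ^ m"
      using x by (intro power_mono) (auto simp: B_def)
    also have "\<dots> \<le> 1 / (1 + 1)" by (rule power_one_minus_le) (use m in auto)
    finally show ?thesis using False by simp
  qed simp
  have "measure_pmf.prob (sample_pair m p) {z. \<forall>x\<in>set (fst z). \<forall>y\<in>set (snd z). \<not> R x y}
     = measure_pmf.expectation ?M (\<lambda>xs. measure_pmf.prob ?M {ys. \<forall>y\<in>set ys. \<forall>x\<in>set xs. \<not> R x y})"
    unfolding prob_eq_expectation expectation_sample_pair[OF fin]
    by (intro Bochner_Integration.integral_cong refl arg_cong[of _ _ of_bool]) auto
  also have "\<dots> \<le> measure_pmf.expectation ?M (\<lambda>xs. 1/2 + 1/2 * of_bool (\<forall>x\<in>set xs. x \<notin> B))"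
    by (intro expectation_mono_finite finite_replicate_pmf fin hit)
  also have "\<dots> = 1/2 + 1/2 * measure_pmf.prob ?M {xs. \<forall>x\<in>set xs. x \<notin> B}"
    unfolding prob_eq_expectation by simp
  also have "measure_pmf.prob ?M {xs. \<forall>x\<in>set xs. x \<notin> B} = (1 - measure_pmf.prob p B) ^ m"
    using compl[of "\<lambda>x. x \<in> B"] by (simp add: prob_list_all[OF fin])
  also have "\<dots> \<le> (1 - (1/8) / m) ^ m"
    using B by (intro power_mono) (auto simp: B_def)
  also have "\<dots> \<le> 1 / (1 + 1/8)" by (rule power_one_minus_le) (use m in auto)
  finally show ?thesis by simp
qed

text \<open>By Bernoulli each list avoids \<open>B\<close> with probability at least 7/8, and the
  square of 7/8 exceeds 3/4.\<close>

lemma prob_hits_le_quarter: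
  assumes fin: "finite (set_pmf p)" and m: "m \<ge> 1"
    and B: "measure_pmf.prob p B \<le> 1 / (8 * real m)"
  shows "measure_pmf.prob (sample_pair m p) {z. \<exists>x\<in>set (fst z) \<union> set (snd z). x \<in> B} \<le> 1/4"
proof -
  let ?M = "replicate_pmf m p" and ?b = "measure_pmf.prob p B"
  let ?g = "measure_pmf.prob ?M {xs. \<forall>x\<in>set xs. x \<notin> B}"
  have "real m * ?b \<le> 1/8" using B m by (simp add: field_simps)
  moreover have "1 + real m * (- ?b) \<le> (1 + (- ?b)) ^ m"
    by (rule Bernoulli_inequality) (auto intro: order_trans[OF measure_pmf.prob_le_1])
  moreover have "?g = (1 - ?b) ^ m"
    using measure_pmf.prob_compl[of B p]
    by (simp add: prob_list_all[OF fin] Compl_eq_Diff_UNIV[symmetric] Collect_neg_eq)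
  ultimately have g: "?g \<ge> 7/8" by simp
  have "measure_pmf.prob (sample_pair m p) {z. \<forall>x\<in>set (fst z) \<union> set (snd z). x \<notin> B}
      = measure_pmf.expectation ?M (\<lambda>xs. measure_pmf.expectation ?M (\<lambda>ys. of_bool (\<forall>x\<in>set xs. x \<notin> B) * of_bool (\<forall>x\<in>set ys. x \<notin> B)))"
    unfolding prob_eq_expectation expectation_sample_pair[OF fin]
    by (intro Bochner_Integration.integral_cong refl) auto
  also have "\<dots> = ?g * ?g"
    unfolding prob_eq_expectation by (simp only: integral_mult_right_zero integral_mult_left_zero mem_Collect_eq)
  also have "\<dots> \<ge> 7/8 * (7/8)" using g by (intro mult_mono) auto
  finally have "3/4 \<le> measure_pmf.prob (sample_pair m p) {z. \<forall>x\<in>set (fst z) \<union> set (snd z). x \<notin> B}" by simp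
  moreover have "{z. \<exists>x\<in>set (fst z) \<union> set (snd z). x \<in> B} = UNIV - {z. \<forall>x\<in>set (fst z) \<union> set (snd z). x \<notin> B}" by auto
  ultimately show ?thesis
    using measure_pmf.prob_compl[of "{z. \<forall>x\<in>set (fst z) \<union> set (snd z). x \<notin> B}" "sample_pair m p"] by simp
qed

text \<open>The last check is one-sided: for the kernels used here the mean of \<open>K\<close> is a
  sum of squares, so only large values of the sum speak against uniformity.\<close>

definition kernel_accepts :: "real \<Rightarrow> real \<Rightarrow> real \<Rightarrow> ('a \<Rightarrow> 'a \<Rightarrow> real) \<Rightarrow> 'a list \<times> 'a list \<Rightarrow> bool" where
  "kernel_accepts t q \<theta> K z \<longleftrightarrow> (\<forall>x\<in>set (fst z). \<forall>y\<in>set (snd z). \<bar>K x y\<bar> \<le> t) \<and>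
     pair_sum (\<lambda>x y. (K x y)\<^sup>2) z \<le> q \<and> pair_sum K z < \<theta>"

lemma pair_sum_ge_member:
  assumes "x \<in> set (fst z)" "y \<in> set (snd z)" "\<And>x y. F x y \<ge> 0"
  shows "F x y \<le> pair_sum F z"
proof -
  have "F x y \<le> (\<Sum>y\<leftarrow>snd z. F x y)"
    using assms by (intro member_le_sum_list) auto
  also have "\<dots> \<le> (\<Sum>x\<leftarrow>fst z. \<Sum>y\<leftarrow>snd z. F x y)"
    using assms by (intro member_le_sum_list) (auto intro!: sum_list_nonneg)
  finally show ?thesis by (simp add: pair_sum_def)
qed

text \<open>A union bound over three applications of Markov's inequality. The first check needs
  fourth moments: with \<open>t\<^sup>2\<close> of order \<open>m * N\<close> the bound
  \<open>m\<^sup>2 * N\<^sup>2 / t ^ 4\<close> stays constant, whereas second moments would leave a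
  factor \<open>m\<close>.\<close>

lemma kernel_accepts_completeness:
  fixes K :: "'a \<Rightarrow> 'a \<Rightarrow> real"
  assumes fin: "finite (set_pmf p)" and pos: "t > 0" "q > 0" "\<theta> > 0"
    and sym: "\<And>x y. K x y = K y x"
    and mean: "\<And>y. y \<in> set_pmf p \<Longrightarrow> measure_pmf.expectation p (K y) = 0"
    and sq: "\<And>y. y \<in> set_pmf p \<Longrightarrow> measure_pmf.expectation p (\<lambda>x. (K y x)\<^sup>2) = N"
    and fourth: "\<And>y. y \<in> set_pmf p \<Longrightarrow> measure_pmf.expectation p (\<lambda>x. (K y x) ^ 4) \<le> c * N\<^sup>2"
  shows "measure_pmf.prob (sample_pair m p) {z. \<not> kernel_accepts t q \<theta> K z}
    \<le> m\<^sup>2 * (c * N\<^sup>2) / t ^ 4 + m\<^sup>2 * N / q + m\<^sup>2 * N / \<theta>\<^sup>2"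
proof -
  let ?M = "sample_pair m p" and ?E = "measure_pmf.expectation p"
  note fp = finite_sample_pair[OF fin, of m]
  have E2sq: "?E (\<lambda>x. ?E (\<lambda>y. (K x y)\<^sup>2)) = N"
    by (subst expectation_cong_pmf[OF sq]) auto
  have h1: "measure_pmf.prob ?M {z. \<exists>x\<in>set (fst z). \<exists>y\<in>set (snd z). \<bar>K x y\<bar> > t} \<le> measure_pmf.expectation ?M (pair_sum (\<lambda>x y. K x y ^ 4)) / t ^ 4"
  proof (rule markov_expectation[OF fp])
    fix z :: "'a list \<times> 'a list" assume "\<exists>x\<in>set (fst z). \<exists>y\<in>set (snd z). \<bar>K x y\<bar> > t"
    then obtain x y where xy: "x \<in> set (fst z)" "y \<in> set (snd z)" "\<bar>K x y\<bar> > t" by auto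
    have "t ^ 4 \<le> \<bar>K x y\<bar> ^ 4" using xy pos by (intro power_mono) auto
    also have "\<dots> = K x y ^ 4" by simp
    also have "\<dots> \<le> pair_sum (\<lambda>x y. K x y ^ 4) z" by (rule pair_sum_ge_member) (use xy in auto)
    finally show "t ^ 4 \<le> pair_sum (\<lambda>x y. K x y ^ 4) z" .
  qed (use pos in \<open>auto simp: pair_sum_def intro!: sum_list_nonneg\<close>)
  have h1': "measure_pmf.expectation ?M (pair_sum (\<lambda>x y. K x y ^ 4)) \<le> m\<^sup>2 * (c * N\<^sup>2)"
  proof -
    have "?E (\<lambda>x. ?E (\<lambda>y. K x y ^ 4)) \<le> ?E (\<lambda>x. c * N\<^sup>2)"
      by (intro expectation_mono_finite fin fourth)
    thus ?thesis unfolding expectation_pair_sum[OF fin] of_nat_power by (intro mult_left_mono) auto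
  qed
  have h2: "measure_pmf.prob ?M {z. pair_sum (\<lambda>x y. (K x y)\<^sup>2) z > q} \<le> measure_pmf.expectation ?M (pair_sum (\<lambda>x y. (K x y)\<^sup>2)) / q"
    by (rule markov_expectation[OF fp]) (use pos in \<open>auto simp: pair_sum_def intro!: sum_list_nonneg\<close>)
  have h2': "measure_pmf.expectation ?M (pair_sum (\<lambda>x y. (K x y)\<^sup>2)) = m\<^sup>2 * N"
    unfolding expectation_pair_sum[OF fin] E2sq by simp
  have h3: "measure_pmf.prob ?M {z. pair_sum K z \<ge> \<theta>} \<le> measure_pmf.expectation ?M (\<lambda>z. (pair_sum K z)\<^sup>2) / \<theta>\<^sup>2"
    by (rule markov_expectation[OF fp]) (use pos in \<open>auto intro!: power_mono\<close>)
  \<comment> \<open>All row means vanish, so distinct entries of the kernel matrix are uncorrelated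
    and only the diagonal term of the second moment survives.\<close>
  have z: "?E (\<lambda>x. (?E (K x))\<^sup>2) = 0" "?E (\<lambda>x. ?E (K x)) = 0"
    using expectation_cong_pmf[of p "\<lambda>x. (?E (K x))\<^sup>2" "\<lambda>_. 0"] expectation_cong_pmf[of p "\<lambda>x. ?E (K x)" "\<lambda>_. 0"] mean by auto
  have "?E (\<lambda>y. (?E (\<lambda>x. K x y))\<^sup>2) = 0" using z(1) sym by simp
  hence h3': "measure_pmf.expectation ?M (\<lambda>z. (pair_sum K z)\<^sup>2) = m\<^sup>2 * N"
    unfolding expectation_pair_sum_square[OF fin] E2sq z by simp
  have "measure_pmf.prob ?M {z. \<not> kernel_accepts t q \<theta> K z}
     \<le> measure_pmf.prob ?M {z. \<exists>x\<in>set (fst z). \<exists>y\<in>set (snd z). \<bar>K x y\<bar> > t} +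
       measure_pmf.prob ?M {z. pair_sum (\<lambda>x y. (K x y)\<^sup>2) z > q \<or> pair_sum K z \<ge> \<theta>}"
    by (rule prob_union_le) (auto simp: kernel_accepts_def not_le not_less)
  also have "measure_pmf.prob ?M {z. pair_sum (\<lambda>x y. (K x y)\<^sup>2) z > q \<or> pair_sum K z \<ge> \<theta>} \<le>
     measure_pmf.prob ?M {z. pair_sum (\<lambda>x y. (K x y)\<^sup>2) z > q} + measure_pmf.prob ?M {z. pair_sum K z \<ge> \<theta>}"
    by (rule prob_union_le) auto
  finally have split: "measure_pmf.prob ?M {z. \<not> kernel_accepts t q \<theta> K z}
     \<le> measure_pmf.prob ?M {z. \<exists>x\<in>set (fst z). \<exists>y\<in>set (snd z). \<bar>K x y\<bar> > t} +
     (measure_pmf.prob ?M {z. pair_sum (\<lambda>x y. (K x y)\<^sup>2) z > q} + measure_pmf.prob ?M {z. pair_sum K z \<ge> \<theta>})" by simp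
  have "measure_pmf.expectation ?M (pair_sum (\<lambda>x y. K x y ^ 4)) / t ^ 4 \<le> m\<^sup>2 * (c * N\<^sup>2) / t ^ 4"
    using h1' pos by (intro divide_right_mono) auto
  with h1 have "measure_pmf.prob ?M {z. \<exists>x\<in>set (fst z). \<exists>y\<in>set (snd z). \<bar>K x y\<bar> > t} \<le> m\<^sup>2 * (c * N\<^sup>2) / t ^ 4" by linarith
  with split show ?thesis using h2 h3 unfolding h2' h3' of_nat_power by linarith
qed

section \<open>Amplification by independent blocks\<close>

text \<open>Unanimity replaces a majority vote: a single test rarely rejects in the uniform case,
  and the acceptance probability in the far case decays geometrically with the number of
  blocks.\<close>

fun blocks_accept :: "nat \<Rightarrow> ('a list \<Rightarrow> bool) \<Rightarrow> nat \<Rightarrow> 'a list \<Rightarrow> bool" where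
  "blocks_accept M a 0 zs \<longleftrightarrow> True"
| "blocks_accept M a (Suc r) zs \<longleftrightarrow> a (take M zs) \<and> blocks_accept M a r (drop M zs)"

lemma expectation_replicate_add:
  fixes h :: "'a list \<Rightarrow> real"
  assumes fin: "finite (set_pmf p)"
  shows "measure_pmf.expectation (replicate_pmf (m + n) p) h =
    measure_pmf.expectation (replicate_pmf m p) (\<lambda>xs. measure_pmf.expectation (replicate_pmf n p) (\<lambda>ys. h (xs @ ys)))"
  unfolding replicate_pmf_distrib using fin by (simp add: expectation_bind_finite)

lemma length_replicate_pmf: "xs \<in> set_pmf (replicate_pmf m p) \<Longrightarrow> length xs = m"
  by (simp add: set_replicate_pmf)

lemma prob_blocks_accept:
  assumes fin: "finite (set_pmf p)"
  shows "measure_pmf.prob (replicate_pmf (r * M) p) {zs. blocks_accept M a r zs} =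
    measure_pmf.prob (replicate_pmf M p) {zs. a zs} ^ r"
proof (induction r)
  case (Suc r)
  have "measure_pmf.prob (replicate_pmf (Suc r * M) p) {zs. blocks_accept M a (Suc r) zs} =
    measure_pmf.expectation (replicate_pmf M p) (\<lambda>xs. measure_pmf.expectation (replicate_pmf (r * M) p)
      (\<lambda>ys. of_bool (blocks_accept M a (Suc r) (xs @ ys))))"
    unfolding prob_eq_expectation by (simp add: expectation_replicate_add[OF fin])
  also have "\<dots> = measure_pmf.expectation (replicate_pmf M p) (\<lambda>xs. measure_pmf.expectation (replicate_pmf (r * M) p)
      (\<lambda>ys. of_bool (a xs) * of_bool (blocks_accept M a r ys)))"
    by (intro expectation_cong_pmf) (auto dest!: length_replicate_pmf)
  also have "\<dots> = measure_pmf.prob (replicate_pmf M p) {zs. a zs} * measure_pmf.prob (replicate_pmf (r * M) p) {zs. blocks_accept M a r zs}"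
    unfolding prob_eq_expectation by (simp only: integral_mult_right_zero integral_mult_left_zero mem_Collect_eq)
  finally show ?case using Suc by simp
qed simp

lemma prob_split_sample:
  assumes fin: "finite (set_pmf p)"
  shows "measure_pmf.prob (replicate_pmf (2 * m) p) {zs. P (take m zs, drop m zs)} =
    measure_pmf.prob (sample_pair m p) {z. P z}"
proof -
  have "measure_pmf.prob (replicate_pmf (2 * m) p) {zs. P (take m zs, drop m zs)} =
    measure_pmf.expectation (replicate_pmf m p) (\<lambda>xs. measure_pmf.expectation (replicate_pmf m p)
      (\<lambda>ys. of_bool (P (take m (xs @ ys), drop m (xs @ ys)))))"
    unfolding prob_eq_expectation mult_2 by (simp add: expectation_replicate_add[OF fin])
  also have "\<dots> = measure_pmf.expectation (replicate_pmf m p) (\<lambda>xs. measure_pmf.expectation (replicate_pmf m p)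
      (\<lambda>ys. of_bool (P (xs, ys))))"
    by (intro expectation_cong_pmf) (auto dest!: length_replicate_pmf)
  finally show ?thesis by (simp add: prob_eq_expectation expectation_sample_pair[OF fin])
qed

subsection \<open>The kernel test: soundness\<close>

text \<open>Soundness uses only that the kernel is the Gram kernel of finitely many features bounded
  by 1 on the support. The tester instantiates the features with characters.\<close>

locale feature_kernel =
  fixes p :: "'a pmf" and I :: "'i set" and \<Phi> :: "'i \<Rightarrow> 'a \<Rightarrow> real" and K :: "'a \<Rightarrow> 'a \<Rightarrow> real"
  assumes fin: "finite (set_pmf p)" and finI: "finite I"
    and bound: "\<And>i x. i \<in> I \<Longrightarrow> x \<in> set_pmf p \<Longrightarrow> \<bar>\<Phi> i x\<bar> \<le> 1"
    and K_eq: "\<And>x y. K x y = (\<Sum>i\<in>I. \<Phi> i x * \<Phi> i y)"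
begin

abbreviation E :: "('a \<Rightarrow> real) \<Rightarrow> real" where "E \<equiv> measure_pmf.expectation p"

lemma int [simp]: "integrable (measure_pmf p) (f :: 'a \<Rightarrow> real)"
  by (rule integrable_measure_pmf_finite[OF fin])

lemma E_mono: "(\<And>x. x \<in> set_pmf p \<Longrightarrow> f x \<le> g x) \<Longrightarrow> E f \<le> E g"
  by (rule expectation_mono_finite[OF fin])

lemma E_nonneg: "(\<And>x. 0 \<le> f x) \<Longrightarrow> 0 \<le> E f"
  by (rule Bochner_Integration.integral_nonneg) auto

lemma E_commute: "E (\<lambda>x. E (\<lambda>y. f x y)) = E (\<lambda>y. E (\<lambda>x. f x y))"
  by (rule expectation_commute[OF fin fin])

lemma K_commute: "K x y = K y x"
  by (simp add: K_eq mult.commute)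

lemma K_bound: "x \<in> set_pmf p \<Longrightarrow> y \<in> set_pmf p \<Longrightarrow> \<bar>K x y\<bar> \<le> card I"
proof -
  assume xy: "x \<in> set_pmf p" "y \<in> set_pmf p"
  have "\<bar>K x y\<bar> \<le> (\<Sum>i\<in>I. \<bar>\<Phi> i x * \<Phi> i y\<bar>)" unfolding K_eq by (rule sum_abs)
  also have "\<dots> \<le> (\<Sum>i\<in>I. 1)"
    using bound xy by (intro sum_mono) (auto simp: abs_mult intro!: mult_le_one)
  finally show ?thesis by simp
qed

text \<open>The kernel operator is positive semidefinite, so Cauchy--Schwarz in feature space bounds
  \<open>\<parallel>K1\<parallel>\<^sup>2\<close> by the operator norm times \<open>\<langle>1, K1\<rangle>\<close>. The operator norm is bounded by the
  Hilbert--Schmidt norm of the truncated part (\<open>\<bar>K\<bar> \<le> t\<close>) plus a Schur bound for the rest.\<close>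

lemma row_means_le:
  fixes g :: "'a \<Rightarrow> real" and t s d :: real
  assumes g: "\<And>x. g x = 0 \<or> g x = 1"
  defines "W \<equiv> (\<Sum>i\<in>I. (E (\<lambda>x. \<Phi> i x * g x))\<^sup>2)"
  defines "h \<equiv> \<lambda>x. E (\<lambda>y. K x y * g x * g y)"
  assumes light: "E (\<lambda>x. E (\<lambda>y. (K x y * of_bool (\<bar>K x y\<bar> \<le> t) * g x * g y)\<^sup>2)) \<le> s\<^sup>2" and s: "s > 0"
    and heavy: "\<And>x. E (\<lambda>y. of_bool (\<bar>K x y\<bar> > t) * g x * g y) \<le> d" and d: "d \<ge> 0"
  shows "E (\<lambda>x. (h x)\<^sup>2) \<le> (s + card I * d) * W"
proof -
  define N where "N = real (card I)"
  define H where "H = E (\<lambda>x. (h x)\<^sup>2)"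
  define \<mu> where "\<mu> i = E (\<lambda>x. \<Phi> i x * g x)" for i
  define \<nu> where "\<nu> i = E (\<lambda>x. h x * \<Phi> i x)" for i
  define L where "L x y = K x y * of_bool (\<bar>K x y\<bar> \<le> t) * g x * g y" for x y
  define b where "b x y = of_bool (\<bar>K x y\<bar> > t) * g x * g y" for x y
  have gg: "g x * g x = g x" for x using g[of x] by auto
  have g0: "g x \<ge> 0" for x using g[of x] by auto
  have b0: "b x y \<ge> 0" for x y using g0 by (simp add: b_def)
  have bs: "b x y = b y x" for x y by (simp add: b_def K_commute[of x y] mult_ac)
  have W0: "W \<ge> 0" unfolding W_def by (intro sum_nonneg) auto
  have H0: "H \<ge> 0" unfolding H_def by (intro E_nonneg) auto
  have hK: "h x = (\<Sum>i\<in>I. \<mu> i * (\<Phi> i x * g x))" for x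
  proof -
    have "K x y * g x * g y = (\<Sum>i\<in>I. (\<Phi> i x * g x) * (\<Phi> i y * g y))" for y
      by (simp add: K_eq sum_distrib_right sum_distrib_left mult_ac)
    hence "h x = E (\<lambda>y. \<Sum>i\<in>I. (\<Phi> i x * g x) * (\<Phi> i y * g y))"
      by (simp add: h_def)
    also have "\<dots> = (\<Sum>i\<in>I. (\<Phi> i x * g x) * \<mu> i)" by (simp add: \<mu>_def)
    finally show ?thesis by (simp add: mult_ac)
  qed
  \<comment> \<open>The cut-off \<open>g\<close> is idempotent and already contained in
    \<open>h\<close>, so factors \<open>g\<close> can be inserted next to \<open>h\<close> at will;
    this is how \<open>L\<close> and \<open>b\<close> enter below.\<close>
  have hg: "h x * g x = h x" for x
    unfolding hK by (simp add: sum_distrib_right mult.assoc gg)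
  have "H = E (\<lambda>x. \<Sum>i\<in>I. \<mu> i * (h x * \<Phi> i x))"
    unfolding H_def
  proof (rule arg_cong[of _ _ E], rule ext)
    fix x
    have "(h x)\<^sup>2 = h x * (\<Sum>i\<in>I. \<mu> i * (\<Phi> i x * g x))" by (simp add: power2_eq_square flip: hK)
    also have "\<dots> = (\<Sum>i\<in>I. \<mu> i * ((h x * g x) * \<Phi> i x))" by (simp add: sum_distrib_left mult_ac)
    finally show "(h x)\<^sup>2 = (\<Sum>i\<in>I. \<mu> i * (h x * \<Phi> i x))" by (simp add: hg)
  qed
  hence "H = (\<Sum>i\<in>I. \<mu> i * \<nu> i)" by (simp add: \<nu>_def)
  hence HW: "H\<^sup>2 \<le> W * (\<Sum>i\<in>I. (\<nu> i)\<^sup>2)"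
    using Cauchy_Schwarz_ineq_sum[of \<mu> \<nu> I] by (simp add: W_def \<mu>_def)
  \<comment> \<open>The squared feature norm of \<open>h\<close> is the quadratic form of the kernel
    at \<open>h\<close>, so it remains to bound that form by a multiple of \<open>H\<close>.\<close>
  have nu: "(\<Sum>i\<in>I. (\<nu> i)\<^sup>2) = E (\<lambda>x. E (\<lambda>y. h x * h y * K x y))"
  proof -
    have "(\<Sum>i\<in>I. (\<nu> i)\<^sup>2) = (\<Sum>i\<in>I. E (\<lambda>x. E (\<lambda>y. (h x * \<Phi> i x) * (h y * \<Phi> i y))))"
      by (simp add: \<nu>_def power2_eq_square)
    also have "\<dots> = E (\<lambda>x. E (\<lambda>y. \<Sum>i\<in>I. (h x * \<Phi> i x) * (h y * \<Phi> i y)))" by simp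
    also have "\<dots> = E (\<lambda>x. E (\<lambda>y. h x * h y * K x y))"
      unfolding K_eq by (simp add: sum_distrib_left mult_ac)
    finally show ?thesis .
  qed
  show ?thesis
  proof (cases "H = 0")
    case True
    thus ?thesis using W0 s d unfolding H_def by simp
  next
    case False
    hence Hpos: "H > 0" using H0 by simp
    \<comment> \<open>On light pairs this is the weighted inequality between geometric and
      arithmetic mean, with weights chosen so that both terms integrate to at most
      \<open>s * H / 2\<close>. On heavy pairs \<open>K\<close> is bounded by \<open>N\<close> and
      the product of \<open>h x\<close> and \<open>h y\<close> by half the sum of squares, as in
      Schur's test.\<close>
    have pt: "h x * h y * K x y \<le> (s / (2 * H)) * ((h x)\<^sup>2 * (h y)\<^sup>2) + (H / (2 * s)) * (L x y)\<^sup>2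
         + (N / 2) * ((h x)\<^sup>2 * b x y) + (N / 2) * ((h y)\<^sup>2 * b y x)"
      if xy: "x \<in> set_pmf p" "y \<in> set_pmf p" for x y
    proof (cases "\<bar>K x y\<bar> \<le> t")
      case True
      have "h x * h y * K x y = (h x * g x) * (h y * g y) * K x y" by (simp add: hg)
      also have "\<dots> = (h x * h y) * L x y" using True by (simp add: L_def mult_ac)
      also have "\<dots> \<le> (s / (2 * H)) * (h x * h y)\<^sup>2 + (H / (2 * s)) * (L x y)\<^sup>2"
      proof -
        have "0 \<le> (s * (h x * h y) - H * L x y)\<^sup>2 / (2 * H * s)" using Hpos s by simp
        also have "\<dots> = (s / (2 * H)) * (h x * h y)\<^sup>2 + (H / (2 * s)) * (L x y)\<^sup>2 - (h x * h y) * L x y"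
          using Hpos s by (simp add: power2_diff field_simps power2_eq_square)
        finally show ?thesis by simp
      qed
      also have "0 \<le> (N / 2) * ((h x)\<^sup>2 * b x y) + (N / 2) * ((h y)\<^sup>2 * b y x)"
        using b0 by (simp add: N_def)
      ultimately show ?thesis by (simp add: power_mult_distrib)
    next
      case False
      have "h x * h y * K x y = (h x * h y * (g x * g y)) * K x y"
        using hg[of x] hg[of y] by (metis mult.assoc mult.left_commute)
      also have "\<dots> = (h x * h y * K x y) * b x y" using False by (simp add: b_def mult_ac)
      also have "\<dots> \<le> (\<bar>h x * h y\<bar> * \<bar>K x y\<bar>) * b x y"
        by (intro mult_right_mono b0) (metis abs_ge_self abs_mult)
      also have "\<dots> \<le> (((h x)\<^sup>2 + (h y)\<^sup>2) / 2 * N) * b x y"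
      proof (intro mult_right_mono b0 mult_mono)
        have "0 \<le> (\<bar>h x\<bar> - \<bar>h y\<bar>)\<^sup>2" by simp
        thus "\<bar>h x * h y\<bar> \<le> ((h x)\<^sup>2 + (h y)\<^sup>2) / 2" by (simp add: power2_diff abs_mult)
      qed (use K_bound[OF xy] in \<open>auto simp: N_def\<close>)
      also have "\<dots> = (N / 2) * ((h x)\<^sup>2 * b x y) + (N / 2) * ((h y)\<^sup>2 * b y x)"
        by (simp add: bs[of y x] field_simps)
      also have "0 \<le> (s / (2 * H)) * ((h x)\<^sup>2 * (h y)\<^sup>2) + (H / (2 * s)) * (L x y)\<^sup>2"
        using Hpos s by simp
      ultimately show ?thesis by linarith
    qed
    have bb: "E (\<lambda>x. E (\<lambda>y. (h x)\<^sup>2 * b x y)) \<le> H * d"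
    proof -
      have "E (\<lambda>x. E (\<lambda>y. (h x)\<^sup>2 * b x y)) = E (\<lambda>x. (h x)\<^sup>2 * E (b x))" by simp
      also have "\<dots> \<le> E (\<lambda>x. (h x)\<^sup>2 * d)"
        using heavy unfolding b_def by (intro E_mono mult_left_mono) auto
      finally show ?thesis by (simp add: H_def)
    qed
    have "(\<Sum>i\<in>I. (\<nu> i)\<^sup>2) \<le> E (\<lambda>x. E (\<lambda>y. (s / (2 * H)) * ((h x)\<^sup>2 * (h y)\<^sup>2) + (H / (2 * s)) * (L x y)\<^sup>2
         + (N / 2) * ((h x)\<^sup>2 * b x y) + (N / 2) * ((h y)\<^sup>2 * b y x)))"
      unfolding nu by (intro E_mono pt)
    also have "\<dots> = (s / (2 * H)) * (H * H) + (H / (2 * s)) * E (\<lambda>x. E (\<lambda>y. (L x y)\<^sup>2))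
        + (N / 2) * E (\<lambda>x. E (\<lambda>y. (h x)\<^sup>2 * b x y)) + (N / 2) * E (\<lambda>x. E (\<lambda>y. (h y)\<^sup>2 * b y x))"
      by (simp add: H_def)
    also have "E (\<lambda>x. E (\<lambda>y. (h y)\<^sup>2 * b y x)) = E (\<lambda>x. E (\<lambda>y. (h x)\<^sup>2 * b x y))"
      by (rule E_commute)
    also have "(H / (2 * s)) * E (\<lambda>x. E (\<lambda>y. (L x y)\<^sup>2)) \<le> (H / (2 * s)) * s\<^sup>2"
      using light Hpos s unfolding L_def by (intro mult_left_mono) auto
    also have "(N / 2) * E (\<lambda>x. E (\<lambda>y. (h x)\<^sup>2 * b x y)) \<le> (N / 2) * (H * d)"
      using bb by (intro mult_left_mono) (auto simp: N_def)
    finally have "(\<Sum>i\<in>I. (\<nu> i)\<^sup>2) \<le> (s / (2 * H)) * (H * H) + (H / (2 * s)) * s\<^sup>2 + (N / 2) * (H * d) + (N / 2) * (H * d)"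
      by simp
    also have "\<dots> = (s + N * d) * H" using Hpos s by (simp add: field_simps power2_eq_square)
    finally have "H\<^sup>2 \<le> W * ((s + N * d) * H)" using HW W0 by (meson mult_left_mono order_trans)
    hence "H * H \<le> ((s + N * d) * W) * H" by (simp add: power2_eq_square mult_ac)
    hence "H \<le> (s + N * d) * W" using Hpos by simp
    thus ?thesis by (simp add: H_def N_def)
  qed
qed

text \<open>Either the points having many heavy partners (\<open>\<bar>K x y\<bar> > t\<close>) carry mass at least \<open>1/(8m)\<close>, and a
  heavy pair is likely to be sampled, or with probability \<open>3/4\<close> no such point is sampled, and one may
  argue with the kernel restricted to the other points. There the lower tail bound is applied to
  the number \<open>b\<close> of heavy pairs, to the sum of the squares of the truncated kernel \<open>L\<close>, and,
  when neither of these forces rejection, to the sum of \<open>L\<close> itself.\<close>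

lemma kernel_accepts_soundness:
  fixes m :: nat and t u D w :: real
  defines "N \<equiv> real (card I)"
  assumes m: "m \<ge> 1" and N: "card I \<ge> 1" and u: "u \<ge> 60" and w: "0 < w" "w \<le> 1"
    and D: "D = 256 * u" and mD: "D * sqrt N / w \<le> m"
    and t: "t > 0" "24 * t\<^sup>2 = u\<^sup>2 * m * N"
    and far: "\<And>B. measure_pmf.prob p B \<le> 1 / (8 * real m) \<Longrightarrow>
       w \<le> (\<Sum>i\<in>I. (E (\<lambda>x. \<Phi> i x * of_bool (x \<notin> B)))\<^sup>2)"
  shows "measure_pmf.prob (sample_pair m p) {z. kernel_accepts t (12 * m * t\<^sup>2) (m\<^sup>2 * w / 4) K z} \<le> 17 / 18"
proof -
  let ?M = "sample_pair m p" and ?acc = "kernel_accepts t (12 * m * t\<^sup>2) (m\<^sup>2 * w / 4) K"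
  define B where "B = {x. 1 / real m < measure_pmf.prob p {y. \<bar>K x y\<bar> > t}}"
  show ?thesis
  proof (cases "1 / (8 * real m) \<le> measure_pmf.prob p B")
    case True
    have "measure_pmf.prob ?M {z. ?acc z} \<le> measure_pmf.prob ?M {z. \<forall>x\<in>set (fst z). \<forall>y\<in>set (snd z). \<not> \<bar>K x y\<bar> > t}"
      by (intro measure_pmf.finite_measure_mono) (auto simp: kernel_accepts_def not_less)
    also have "\<dots> \<le> 17 / 18"
      using True unfolding B_def by (intro prob_no_related_pair[OF fin m])
    finally show ?thesis .
  next
    case False
    hence pB: "measure_pmf.prob p B \<le> 1 / (8 * real m)" by simp
    define g where "g x = (of_bool (x \<notin> B) :: real)" for x
    define W where "W = (\<Sum>i\<in>I. (E (\<lambda>x. \<Phi> i x * g x))\<^sup>2)"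
    define b where "b x y = of_bool (\<bar>K x y\<bar> > t) * g x * g y" for x y
    define L where "L x y = K x y * of_bool (\<bar>K x y\<bar> \<le> t) * g x * g y" for x y
    define h where "h x = E (\<lambda>y. K x y * g x * g y)" for x
    define e where "e = E (\<lambda>x. E (b x))"
    define A where "A = E (\<lambda>x. E (\<lambda>y. (L x y)\<^sup>2))"
    define T where "T = E (\<lambda>x. E (L x))"
    have mpos: "real m > 0" using m by simp
    have Npos: "N \<ge> 1" using N by (simp add: N_def)
    have W: "w \<le> W" using far[OF pB] by (simp add: W_def g_def)
    have g01: "g x = 0 \<or> g x = 1" for x by (simp add: g_def)
    have g0: "g x \<ge> 0" "g x \<le> 1" for x by (simp_all add: g_def)
    have b0: "b x y \<ge> 0" for x y by (simp add: b_def g_def)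
    have bsq: "(b x y)\<^sup>2 = b x y" for x y by (simp add: b_def g_def)
    have bs: "b x y = b y x" for x y by (simp add: b_def K_commute[of x y] mult_ac)
    have Ls: "L x y = L y x" for x y by (simp add: L_def K_commute[of x y] mult_ac)
    have e0: "e \<ge> 0" unfolding e_def by (intro E_nonneg b0)
    have deg: "E (b x) \<le> 1 / m" for x
    proof (cases "x \<in> B")
      case True thus ?thesis by (simp add: b_def[abs_def] g_def)
    next
      case False
      have "E (b x) \<le> E (\<lambda>y. of_bool (y \<in> {y. \<bar>K x y\<bar> > t}))"
        by (intro E_mono) (auto simp: b_def g_def)
      also have "\<dots> \<le> 1 / m" using False unfolding prob_eq_expectation[symmetric] by (simp add: B_def)
      finally show ?thesis .
    qed
    have deg0: "E (b x) \<ge> 0" for x by (intro E_nonneg b0)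
    have deg2: "E (\<lambda>x. (E (b x))\<^sup>2) \<le> e / m"
    proof -
      have "E (\<lambda>x. (E (b x))\<^sup>2) \<le> E (\<lambda>x. E (b x) * (1 / m))"
        unfolding power2_eq_square by (intro E_mono mult_left_mono deg deg0)
      thus ?thesis by (simp add: e_def)
    qed
    \<comment> \<open>Each remaining case supplies a statistic \<open>F\<close> which acceptance
      forces below half its mean unless \<open>B\<close> is hit. The two failure probabilities add
      up to 1/4 + 1/2 = 3/4, which is below 17/18.\<close>
    have reduce: ?thesis
      if acc: "\<And>z. ?acc z \<Longrightarrow> \<forall>x\<in>set (fst z) \<union> set (snd z). x \<notin> B \<Longrightarrow> pair_sum F z \<le> m\<^sup>2 * a / 2"
        and a: "a = E (\<lambda>x. E (F x))" "a > 0" and F: "\<And>x y. F x y = F y x"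
        and tail: "4 * (E (\<lambda>x. E (\<lambda>y. (F x y)\<^sup>2)) / m\<^sup>2 + 2 * E (\<lambda>x. (E (F x))\<^sup>2) / m) / a\<^sup>2 \<le> 1/2" for F and a :: real
    proof -
      have "measure_pmf.prob ?M {z. ?acc z} \<le> measure_pmf.prob ?M {z. \<exists>x\<in>set (fst z) \<union> set (snd z). x \<in> B}
          + measure_pmf.prob ?M {z. pair_sum F z \<le> m\<^sup>2 * a / 2}"
        by (rule prob_union_le) (use acc in blast)
      also have "measure_pmf.prob ?M {z. pair_sum F z \<le> m\<^sup>2 * a / 2} \<le> 1/2"
        using pair_sum_lower_tail[OF fin m, of F, folded a(1), OF a(2) F] tail unfolding of_nat_power by linarith
      also have "measure_pmf.prob ?M {z. \<exists>x\<in>set (fst z) \<union> set (snd z). x \<in> B} \<le> 1/4"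
        by (rule prob_hits_le_quarter[OF fin m pB])
      finally show ?thesis by simp
    qed
    \<comment> \<open>Above these thresholds the lower tail bounds
      \<open>12 / (m\<^sup>2 * e)\<close> and \<open>12 * t\<^sup>2 / (m * A)\<close> are at most
      1/2. The second threshold also puts the acceptance limit \<open>12 * m * t\<^sup>2\<close> at
      or below half the mean of the sum of squares.\<close>
    consider "e \<ge> 24 / m\<^sup>2" | "A \<ge> 24 * t\<^sup>2 / m" | "e < 24 / m\<^sup>2" "A < 24 * t\<^sup>2 / m" by linarith
    thus ?thesis
    proof cases
      case 1
      have "0 < 24 / (real m)\<^sup>2" using mpos by simp
      hence epos: "e > 0" using 1 unfolding of_nat_power by linarith
      show ?thesis
      proof (rule reduce[of b e])
        fix z assume "?acc z"
        hence "\<forall>x\<in>set (fst z). \<forall>y\<in>set (snd z). \<not> \<bar>K x y\<bar> > t"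
          by (auto simp: kernel_accepts_def not_less)
        hence "pair_sum b z \<le> pair_sum (\<lambda>_ _. 0) z"
          by (intro pair_sum_mono) (simp add: b_def)
        also have "\<dots> = 0" by (simp add: pair_sum_def)
        also have "0 \<le> m\<^sup>2 * e / 2" using epos by simp
        finally show "pair_sum b z \<le> m\<^sup>2 * e / 2" .
      next
        have "4 * (E (\<lambda>x. E (\<lambda>y. (b x y)\<^sup>2)) / m\<^sup>2 + 2 * E (\<lambda>x. (E (b x))\<^sup>2) / m) / e\<^sup>2
          \<le> 4 * (e / m\<^sup>2 + 2 * (e / m) / m) / e\<^sup>2"
          using deg2 mpos unfolding bsq e_def[symmetric]
          by (intro divide_right_mono mult_left_mono add_left_mono) auto
        also have "\<dots> = 12 / (m\<^sup>2 * e)" using epos mpos by (simp add: field_simps power2_eq_square)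
        also have "\<dots> \<le> 1/2" using 1 epos mpos by (simp add: field_simps)
        finally show "4 * (E (\<lambda>x. E (\<lambda>y. (b x y)\<^sup>2)) / m\<^sup>2 + 2 * E (\<lambda>x. (E (b x))\<^sup>2) / m) / e\<^sup>2 \<le> 1/2" .
      qed (use epos bs in \<open>auto simp: e_def\<close>)
    next
      case 2
      have "0 < 24 * t\<^sup>2 / m" using mpos t(1) by simp
      hence Apos: "A > 0" using 2 by linarith
      have Lt: "(L x y)\<^sup>2 \<le> t\<^sup>2" for x y
      proof -
        have "\<bar>L x y\<bar> \<le> t" using t by (auto simp: L_def g_def)
        thus ?thesis using t by (simp add: abs_le_square_iff[symmetric])
      qed
      have ELt: "E (\<lambda>y. (L x y)\<^sup>2) \<le> t\<^sup>2" for x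
        using E_mono[of "\<lambda>y. (L x y)\<^sup>2" "\<lambda>_. t\<^sup>2"] Lt by simp
      have EL0: "0 \<le> E (\<lambda>y. (L x y)\<^sup>2)" for x by (intro E_nonneg) simp
      show ?thesis
      proof (rule reduce[of "\<lambda>x y. (L x y)\<^sup>2" A])
        fix z assume "?acc z"
        have "pair_sum (\<lambda>x y. (L x y)\<^sup>2) z \<le> pair_sum (\<lambda>x y. (K x y)\<^sup>2) z"
          by (intro pair_sum_mono) (auto simp: L_def g_def)
        also have "\<dots> \<le> 12 * m * t\<^sup>2" using \<open>?acc z\<close> by (simp add: kernel_accepts_def)
        also have "\<dots> \<le> m\<^sup>2 * A / 2" using 2 mpos by (simp add: field_simps power2_eq_square)
        finally show "pair_sum (\<lambda>x y. (L x y)\<^sup>2) z \<le> m\<^sup>2 * A / 2" .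
      next
        have q1: "E (\<lambda>x. E (\<lambda>y. ((L x y)\<^sup>2)\<^sup>2)) \<le> t\<^sup>2 * A"
        proof -
          have "E (\<lambda>x. E (\<lambda>y. ((L x y)\<^sup>2)\<^sup>2)) \<le> E (\<lambda>x. E (\<lambda>y. t\<^sup>2 * (L x y)\<^sup>2))"
            unfolding power2_eq_square[of "(L _ _)\<^sup>2"] by (intro E_mono mult_right_mono Lt) auto
          thus ?thesis by (simp add: A_def)
        qed
        have q2: "E (\<lambda>x. (E (\<lambda>y. (L x y)\<^sup>2))\<^sup>2) \<le> t\<^sup>2 * A"
        proof -
          have "E (\<lambda>x. (E (\<lambda>y. (L x y)\<^sup>2))\<^sup>2) \<le> E (\<lambda>x. t\<^sup>2 * E (\<lambda>y. (L x y)\<^sup>2))"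
            unfolding power2_eq_square[of "E _"] by (intro E_mono mult_right_mono ELt EL0)
          thus ?thesis by (simp add: A_def)
        qed
        have "4 * (E (\<lambda>x. E (\<lambda>y. ((L x y)\<^sup>2)\<^sup>2)) / m\<^sup>2 + 2 * E (\<lambda>x. (E (\<lambda>y. (L x y)\<^sup>2))\<^sup>2) / m) / A\<^sup>2
           \<le> 4 * (t\<^sup>2 * A / m\<^sup>2 + 2 * (t\<^sup>2 * A) / m) / A\<^sup>2"
          using q1 q2 by (intro divide_right_mono mult_left_mono add_mono) auto
        also have "\<dots> \<le> 4 * (t\<^sup>2 * A / m + 2 * (t\<^sup>2 * A) / m) / A\<^sup>2"
          using m Apos by (intro divide_right_mono mult_left_mono add_right_mono divide_left_mono)
            (auto simp: power2_eq_square)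
        also have "\<dots> = 12 * t\<^sup>2 / (m * A)" using Apos mpos by (simp add: field_simps power2_eq_square)
        also have "\<dots> \<le> 1/2" using 2 Apos mpos by (simp add: field_simps)
        finally show "4 * (E (\<lambda>x. E (\<lambda>y. ((L x y)\<^sup>2)\<^sup>2)) / m\<^sup>2 + 2 * E (\<lambda>x. (E (\<lambda>y. (L x y)\<^sup>2))\<^sup>2) / m) / A\<^sup>2 \<le> 1/2" .
      qed (use Apos Ls in \<open>auto simp: A_def\<close>)
    next
      case 3
      \<comment> \<open>\<open>s\<close> bounds the Hilbert-Schmidt norm of the truncated kernel,
        because \<open>24 * t\<^sup>2 / m\<close> equals \<open>s\<^sup>2\<close>. The ratio
        \<open>r\<close> collects the lower-order errors; the sample size makes it at most
        \<open>w\<^sup>2 / D\<^sup>2\<close>.\<close>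
      define s where "s = u * sqrt N"
      define r where "r = N / m\<^sup>2"
      have spos: "s > 0" using u Npos by (simp add: s_def)
      have ss: "s\<^sup>2 = 24 * t\<^sup>2 / m"
        using t(2) mpos Npos by (simp add: s_def power_mult_distrib field_simps)
      have As: "A \<le> s\<^sup>2" using 3 ss by simp
      have Dpos: "D > 0" using D u by simp
      have mw: "D * sqrt N \<le> m * w" using mD w by (simp add: field_simps)
      have "D\<^sup>2 * N \<le> (m * w)\<^sup>2"
        using power_mono[OF mw, of 2] Dpos Npos by (simp add: power_mult_distrib)
      hence rw: "r \<le> w\<^sup>2 / D\<^sup>2"
        using mpos Dpos by (simp add: r_def field_simps power_mult_distrib)
      have r0: "r \<ge> 0" using Npos by (simp add: r_def)
      have D256: "D \<ge> 15360" using D u by simp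
      have Wpos: "W > 0" using W w by simp
      have D2: "D\<^sup>2 \<ge> 15360\<^sup>2" using D256 by (intro power_mono) auto
      have ww: "w\<^sup>2 \<le> w" using w by (simp add: power2_eq_square mult_left_le)
      have rw': "r \<le> w / D\<^sup>2"
        using rw ww by (meson divide_right_mono order_trans zero_le_power2)
      have "w / D\<^sup>2 \<le> w / 15360\<^sup>2" using D2 w Dpos by (intro divide_left_mono) auto
      also have "\<dots> \<le> w / 48" using w by simp
      finally have r48: "48 * r \<le> w" using rw' by linarith
      have hW: "E (\<lambda>x. (h x)\<^sup>2) \<le> (s + N * (1 / m)) * W"
        unfolding h_def W_def N_def
        by (rule row_means_le[where t = t]) (use g01 As spos deg[unfolded b_def[abs_def]] in \<open>auto simp: A_def L_def\<close>)
      have EhW: "E h = W"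
      proof -
        have "K x y * g x * g y = (\<Sum>i\<in>I. (\<Phi> i x * g x) * (\<Phi> i y * g y))" for x y
          by (simp add: K_eq sum_distrib_right sum_distrib_left mult_ac)
        hence "E h = E (\<lambda>x. E (\<lambda>y. \<Sum>i\<in>I. (\<Phi> i x * g x) * (\<Phi> i y * g y)))"
          by (simp add: h_def[abs_def])
        also have "\<dots> = (\<Sum>i\<in>I. E (\<lambda>x. \<Phi> i x * g x) * E (\<lambda>y. \<Phi> i y * g y))" by simp
        finally show ?thesis by (simp add: W_def power2_eq_square)
      qed
      \<comment> \<open>Dropping heavy pairs from a row changes its mean by at most \<open>N\<close>
        times their mass.\<close>
      have hL: "\<bar>h x - E (L x)\<bar> \<le> N * E (b x)" if x: "x \<in> set_pmf p" for x
      proof -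
        have "h x - E (L x) = E (\<lambda>y. K x y * b x y)"
          unfolding h_def Bochner_Integration.integral_diff[OF int int, symmetric]
          by (intro Bochner_Integration.integral_cong refl) (auto simp: L_def b_def)
        also have "\<bar>\<dots>\<bar> \<le> E (\<lambda>y. \<bar>K x y * b x y\<bar>)" by (rule integral_abs_bound)
        also have "\<dots> \<le> E (\<lambda>y. N * b x y)"
          using K_bound[OF x] b0 by (intro E_mono) (auto simp: abs_mult N_def intro!: mult_right_mono)
        finally show ?thesis by simp
      qed
      \<comment> \<open>Truncation lowers the mean by at most \<open>N * e\<close>, which is below
        \<open>24 * r\<close> in this case and hence at most half of \<open>w\<close>.\<close>
      have TW: "T \<ge> W / 2"
      proof -
        have "W - T = E (\<lambda>x. h x - E (L x))" by (simp add: T_def EhW)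
        also have "\<dots> \<le> E (\<lambda>x. N * E (b x))"
          using hL by (intro E_mono) (smt (verit))
        also have "\<dots> = N * e" by (simp add: e_def)
        also have "\<dots> \<le> N * (24 / m\<^sup>2)" using 3 Npos by (intro mult_left_mono) auto
        also have "\<dots> = 24 * r" by (simp add: r_def)
        also have "\<dots> \<le> w / 2" using r48 by simp
        finally show ?thesis using W by simp
      qed
      \<comment> \<open>The square of a sum is at most twice the sum of squares. The degree bound
        \<open>1 / m\<close> turns the squared heavy degrees into \<open>e / m\<close>, which
        supplies the last term.\<close>
      have ET: "E (\<lambda>x. (E (L x))\<^sup>2) \<le> 2 * ((s + N / m) * W) + 48 * N\<^sup>2 / m ^ 3"
      proof -
        have "E (\<lambda>x. (E (L x))\<^sup>2) \<le> E (\<lambda>x. 2 * (h x)\<^sup>2 + 2 * (N\<^sup>2 * (E (b x))\<^sup>2))"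
        proof (rule E_mono)
          fix x assume x: "x \<in> set_pmf p"
          have "(h x - E (L x))\<^sup>2 \<le> (N * E (b x))\<^sup>2"
            using hL[OF x] deg0 Npos by (simp add: abs_le_square_iff[symmetric])
          moreover have "0 \<le> (h x + (h x - E (L x)))\<^sup>2" by simp
          ultimately show "(E (L x))\<^sup>2 \<le> 2 * (h x)\<^sup>2 + 2 * (N\<^sup>2 * (E (b x))\<^sup>2)"
            by (simp add: power_mult_distrib power2_eq_square algebra_simps)
        qed
        also have "\<dots> = 2 * E (\<lambda>x. (h x)\<^sup>2) + 2 * (N\<^sup>2 * E (\<lambda>x. (E (b x))\<^sup>2))" by simp
        also have "\<dots> \<le> 2 * ((s + N * (1 / m)) * W) + 2 * (N\<^sup>2 * (e / m))"
          using hW deg2 by (intro add_mono mult_left_mono) auto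
        also have "\<dots> \<le> 2 * ((s + N * (1 / m)) * W) + 2 * (N\<^sup>2 * ((24 / m\<^sup>2) / m))"
          using 3 by (intro add_left_mono mult_left_mono divide_right_mono) auto
        finally show ?thesis by (simp add: power2_eq_square power3_eq_cube mult.assoc)
      qed
      have Tpos: "T > 0" using TW Wpos by simp
      show ?thesis
      proof (rule reduce[of L T])
        fix z assume z: "?acc z" "\<forall>x\<in>set (fst z) \<union> set (snd z). x \<notin> B"
        have "pair_sum L z \<le> pair_sum K z"
          using z by (intro pair_sum_mono) (simp add: kernel_accepts_def L_def g_def)
        also have "\<dots> \<le> m\<^sup>2 * w / 4" using z by (simp add: kernel_accepts_def)
        also have "\<dots> = m\<^sup>2 * (w / 2) / 2" by simp
        also have "\<dots> \<le> m\<^sup>2 * T / 2" using TW W by (intro divide_right_mono mult_left_mono) auto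
        finally show "pair_sum L z \<le> m\<^sup>2 * T / 2" .
      next
        have x1: "s\<^sup>2 / m\<^sup>2 = u\<^sup>2 * r" using Npos by (simp add: s_def r_def power_mult_distrib)
        have x2: "(s + N / m) / m \<le> u * w / D + w / D\<^sup>2"
        proof -
          have "s / m \<le> u * w / D" using mw mpos Dpos u by (simp add: s_def field_simps mult_left_mono)
          moreover have "(s + N / m) / m = s / m + r" by (simp add: r_def add_divide_distrib power2_eq_square)
          ultimately show ?thesis using rw' by simp
        qed
        have "4 * (E (\<lambda>x. E (\<lambda>y. (L x y)\<^sup>2)) / m\<^sup>2 + 2 * E (\<lambda>x. (E (L x))\<^sup>2) / m) / T\<^sup>2
          \<le> 4 * (s\<^sup>2 / m\<^sup>2 + 2 * (2 * ((s + N / m) * W) + 48 * N\<^sup>2 / m ^ 3) / m) / T\<^sup>2"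
          using As ET unfolding A_def by (intro divide_right_mono mult_left_mono add_mono) auto
        also have "\<dots> = 4 * (u\<^sup>2 * r + 4 * W * ((s + N / m) / m) + 96 * r\<^sup>2) / T\<^sup>2"
          unfolding x1[symmetric] using mpos by (simp add: r_def field_simps power2_eq_square power3_eq_cube)
        also have "\<dots> \<le> 4 * (u\<^sup>2 * (W\<^sup>2 / D\<^sup>2) + 4 * W * (u * W / D + W / D\<^sup>2) + 96 * (W / D\<^sup>2)\<^sup>2) / T\<^sup>2"
        proof (intro divide_right_mono mult_left_mono add_mono)
          show "r \<le> W\<^sup>2 / D\<^sup>2" using rw W w
            by (smt (verit, best) divide_right_mono power_mono zero_le_power2)
          have "u * w / D + w / D\<^sup>2 \<le> u * W / D + W / D\<^sup>2"
            using W u Dpos by (intro add_mono divide_right_mono mult_left_mono) auto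
          thus "(s + N / m) / m \<le> u * W / D + W / D\<^sup>2" using x2 by simp
          have "w / D\<^sup>2 \<le> W / D\<^sup>2" using W by (intro divide_right_mono) auto
          thus "r\<^sup>2 \<le> (W / D\<^sup>2)\<^sup>2" using rw' r0 by (intro power_mono) auto
        qed (use Wpos in auto)
        also have "\<dots> \<le> 4 * (u\<^sup>2 * (W\<^sup>2 / D\<^sup>2) + 4 * W * (u * W / D + W / D\<^sup>2) + 96 * (W / D\<^sup>2)\<^sup>2) / (W / 2)\<^sup>2"
        proof (intro divide_left_mono)
          show "(W / 2)\<^sup>2 \<le> T\<^sup>2" using TW Wpos by (intro power_mono) auto
        qed (use Wpos Tpos u Dpos in \<open>auto intro!: add_nonneg_nonneg\<close>)
        also have "\<dots> = 16 * ((u / D)\<^sup>2 + 4 * (u / D) + 4 / D\<^sup>2 + 96 / (D\<^sup>2)\<^sup>2)"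
          using Wpos Dpos by (simp add: field_simps power2_eq_square)
        \<comment> \<open>This ratio dictates \<open>D = 256 * u\<close>: the dominant contribution
          is 16 * 4 / 256 = 1/4, and the other terms fit into the remaining 1/4.\<close>
        also have "u / D = 1 / 256" using D u by simp
        also have "16 * ((1 / 256 :: real)\<^sup>2 + 4 * (1 / 256) + 4 / D\<^sup>2 + 96 / (D\<^sup>2)\<^sup>2)
           \<le> 16 * ((1 / 256)\<^sup>2 + 4 * (1 / 256) + 4 / 15360\<^sup>2 + 96 / (15360\<^sup>2)\<^sup>2)"
          using D2 D256 by (intro mult_left_mono add_mono divide_left_mono power_mono) auto
        also have "\<dots> \<le> 1/2" by (simp add: power2_eq_square)
        finally show "4 * (E (\<lambda>x. E (\<lambda>y. (L x y)\<^sup>2)) / m\<^sup>2 + 2 * E (\<lambda>x. (E (L x))\<^sup>2) / m) / T\<^sup>2 \<le> 1/2" .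
      qed (use Tpos Ls in \<open>auto simp: T_def\<close>)
    qed
  qed
qed

end

subsection \<open>Fourier analysis on the cube\<close>

lemma finite_cube [simp]: "finite (cube n)"
  by (auto simp: cube_def intro!: finite_PiE)

lemma cube_0: "cube 0 = {\<lambda>_. undefined}"
  by (simp add: cube_def)

text \<open>Conditioning on the last coordinate; this drives the inductions on the dimension for the
  mean of a character and for the fourth-moment bound.\<close>

lemma sum_cube_Suc:
  "sum f (cube (Suc n)) = (\<Sum>x\<in>cube n. f (x(n := 1)) + f (x(n := -1)))"
proof -
  have "cube (Suc n) = (\<lambda>(y, g). g(n := y)) ` ({-1, 1} \<times> cube n)"
    unfolding cube_def lessThan_Suc by (rule PiE_insert_eq)
  moreover have "inj_on (\<lambda>(y, g). g(n := y)) ({-1, 1} \<times> cube n)"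
    unfolding cube_def by (rule inj_combinator) simp
  ultimately have "sum f (cube (Suc n)) = (\<Sum>(y, g)\<in>{-1, 1} \<times> cube n. f (g(n := y)))"
    by (simp add: sum.reindex case_prod_unfold o_def)
  also have "\<dots> = (\<Sum>y\<in>{-1, 1}. \<Sum>g\<in>cube n. f (g(n := y)))"
    by (rule sum.cartesian_product[symmetric])
  finally show ?thesis by (simp add: sum.distrib add.commute)
qed

lemma card_cube: "card (cube n) = 2 ^ n"
  by (simp add: cube_def card_PiE numeral_2_eq_2)

lemma cube_nonempty: "cube n \<noteq> {}"
  using card_cube[of n] by (metis card.empty power_not_zero zero_neq_numeral)

lemma unif_expect_sum: "unif_expect n f = (\<Sum>x\<in>cube n. f x) / 2 ^ n"
  unfolding unif_expect_def
  by (subst integral_pmf_of_set) (auto simp: cube_nonempty card_cube)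

lemma unif_expect_Suc:
  "unif_expect (Suc n) f = unif_expect n (\<lambda>x. (f (x(n := 1)) + f (x(n := -1))) / 2)"
  by (simp add: unif_expect_sum sum_cube_Suc flip: sum_divide_distrib)

lemma unif_expect_add [simp]: "unif_expect n (\<lambda>x. f x + g x) = unif_expect n f + unif_expect n g"
  by (simp add: unif_expect_sum sum.distrib add_divide_distrib)

lemma unif_expect_diff [simp]: "unif_expect n (\<lambda>x. f x - g x) = unif_expect n f - unif_expect n g"
  by (simp add: unif_expect_sum sum_subtractf diff_divide_distrib)

lemma unif_expect_cmult [simp]: "unif_expect n (\<lambda>x. c * f x) = c * unif_expect n f"
  by (simp add: unif_expect_sum flip: sum_distrib_left)

lemma unif_expect_multc [simp]: "unif_expect n (\<lambda>x. f x * c) = unif_expect n f * c"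
  by (simp add: unif_expect_sum flip: sum_distrib_right)

lemma unif_expect_divide [simp]: "unif_expect n (\<lambda>x. f x / c) = unif_expect n f / c"
  by (simp add: unif_expect_sum flip: sum_divide_distrib)

lemma unif_expect_const [simp]: "unif_expect n (\<lambda>x. c) = c"
  by (simp add: unif_expect_sum card_cube)

lemma unif_expect_sum_commute [simp]:
  "unif_expect n (\<lambda>x. \<Sum>i\<in>A. f i x) = (\<Sum>i\<in>A. unif_expect n (f i))"
  by (simp add: unif_expect_sum sum.swap[of _ "cube n"] flip: sum_divide_distrib)

lemma unif_expect_mono: "(\<And>x. x \<in> cube n \<Longrightarrow> f x \<le> g x) \<Longrightarrow> unif_expect n f \<le> unif_expect n g"
  by (simp add: unif_expect_sum divide_right_mono sum_mono)

lemma unif_expect_cong: "(\<And>x. x \<in> cube n \<Longrightarrow> f x = g x) \<Longrightarrow> unif_expect n f = unif_expect n g"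
  by (simp add: unif_expect_sum)

lemma unif_expect_Cauchy_Schwarz:
  "(unif_expect n (\<lambda>x. f x * g x))\<^sup>2 \<le> unif_expect n (\<lambda>x. (f x)\<^sup>2) * unif_expect n (\<lambda>x. (g x)\<^sup>2)"
  using Cauchy_Schwarz_ineq_sum[of f g "cube n"]
  by (simp add: unif_expect_sum divide_right_mono power2_eq_square)

subsection \<open>Characters and low-degree polynomials\<close>

definition chi :: "nat set \<Rightarrow> point \<Rightarrow> real" where
  "chi S x = (\<Prod>i\<in>S. x i)"

lemma chi_empty [simp]: "chi {} x = 1"
  by (simp add: chi_def)

lemma fourier_coeff_chi: "fourier_coeff n \<phi> S = unif_expect n (\<lambda>x. \<phi> x * chi S x)"
  by (simp add: fourier_coeff_def chi_def)

lemma cube_coord: "x \<in> cube n \<Longrightarrow> i < n \<Longrightarrow> x i = 1 \<or> x i = -1"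
  by (auto simp: cube_def PiE_iff)

lemma chi_square:
  assumes "x \<in> cube n" "S \<subseteq> {..<n}"
  shows "chi S x * chi S x = 1"
proof -
  have "chi S x * chi S x = (\<Prod>i\<in>S. x i * x i)" by (simp add: chi_def prod.distrib)
  also have "\<dots> = 1" using assms cube_coord[OF assms(1)] by (intro prod.neutral) fastforce
  finally show ?thesis .
qed

lemma abs_chi: "x \<in> cube n \<Longrightarrow> S \<subseteq> {..<n} \<Longrightarrow> \<bar>chi S x\<bar> = 1"
  using chi_square[of x n S] by (metis abs_mult_self_eq abs_1 abs_square_eq_1 power2_eq_square)

text \<open>Coordinates in both sets occur squared and cancel, so the symmetric difference
  remains.\<close>

lemma chi_mult:
  assumes x: "x \<in> cube n" and S: "S \<subseteq> {..<n}" and T: "T \<subseteq> {..<n}"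
  shows "chi S x * chi T x = chi ((S - T) \<union> (T - S)) x"
proof -
  have fin: "finite S" "finite T" using S T finite_subset by auto
  have dec: "chi A x = chi (A - C) x * chi (A \<inter> C) x" if "finite A" for A C
    unfolding chi_def using that by (subst prod.union_disjoint[symmetric]) (auto intro!: prod.cong)
  have "chi S x * chi T x = chi (S - T) x * chi (T - S) x * (chi (S \<inter> T) x * chi (S \<inter> T) x)"
    using dec[OF fin(1), of T] dec[OF fin(2), of S] by (simp add: Int_commute mult_ac)
  also have "chi (S \<inter> T) x * chi (S \<inter> T) x = 1" by (rule chi_square[OF x]) (use S in auto)
  also have "chi (S - T) x * chi (T - S) x = chi ((S - T) \<union> (T - S)) x"
    unfolding chi_def using fin by (subst prod.union_disjoint) auto
  finally show ?thesis by simp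
qed

lemma chi_upd: "S \<subseteq> {..<n} \<Longrightarrow> chi S (x(n := s)) = chi S x"
  unfolding chi_def by (intro prod.cong) auto

lemma chi_insert_upd: "S \<subseteq> {..<n} \<Longrightarrow> chi (insert n S) (x(n := s)) = s * chi S x"
proof -
  assume S: "S \<subseteq> {..<n}"
  hence "finite S" "n \<notin> S" using finite_subset by auto
  thus ?thesis using chi_upd[OF S, of x s] by (simp add: chi_def)
qed

lemma unif_expect_chi: "S \<subseteq> {..<n} \<Longrightarrow> unif_expect n (chi S) = of_bool (S = {})"
proof (induction n arbitrary: S)
  case 0
  thus ?case by (simp add: unif_expect_const[of 0 1])
next
  case (Suc n)
  show ?case
  proof (cases "n \<in> S")
    case True
    define R where "R = S - {n}"
    have R: "R \<subseteq> {..<n}" "S = insert n R" using Suc.prems True by (auto simp: R_def)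
    show ?thesis using R by (simp add: unif_expect_Suc chi_insert_upd)
  next
    case False
    hence R: "S \<subseteq> {..<n}" using Suc.prems by (auto simp: less_Suc_eq)
    have "unif_expect (Suc n) (chi S) = unif_expect n (chi S)"
      using R by (simp add: unif_expect_Suc chi_upd)
    thus ?thesis using Suc.IH[OF R] by simp
  qed
qed

lemma unif_expect_chi_mult:
  assumes "S \<subseteq> {..<n}" "T \<subseteq> {..<n}"
  shows "unif_expect n (\<lambda>x. chi S x * chi T x) = of_bool (S = T)"
proof -
  have "unif_expect n (\<lambda>x. chi S x * chi T x) = unif_expect n (chi ((S - T) \<union> (T - S)))"
    using assms by (intro unif_expect_cong chi_mult)
  also have "\<dots> = of_bool ((S - T) \<union> (T - S) = {})"
    using assms by (intro unif_expect_chi) auto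
  also have "(S - T) \<union> (T - S) = {} \<longleftrightarrow> S = T" by auto
  finally show ?thesis .
qed

section \<open>Polynomials of degree at most \<open>k\<close>\<close>

text \<open>The empty set is included so that the mean is prescribed together with the other
  coefficients; the kernel leaves it out explicitly.\<close>

definition lowdeg :: "nat \<Rightarrow> nat \<Rightarrow> nat set set" where
  "lowdeg n k = {S. S \<subseteq> {..<n} \<and> card S \<le> k}"

lemma finite_lowdeg [simp]: "finite (lowdeg n k)"
  unfolding lowdeg_def by (rule finite_subset[of _ "Pow {..<n}"]) auto

lemma empty_in_lowdeg [simp]: "{} \<in> lowdeg n k"
  by (simp add: lowdeg_def)

lemma lowdegD: "S \<in> lowdeg n k \<Longrightarrow> S \<subseteq> {..<n}" "S \<in> lowdeg n k \<Longrightarrow> card S \<le> k"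
  by (auto simp: lowdeg_def)

lemma lowdeg_0_left: "lowdeg 0 k = {{}}"
  by (auto simp: lowdeg_def)

lemma lowdeg_0_right: "lowdeg n 0 = {{}}"
  by (auto simp: lowdeg_def dest: finite_subset)

lemma lowdeg_Suc_Suc:
  "lowdeg (Suc n) (Suc k) = lowdeg n (Suc k) \<union> insert n ` lowdeg n k"
proof (intro equalityI subsetI)
  fix S assume S: "S \<in> lowdeg (Suc n) (Suc k)"
  hence fS: "finite S" using finite_subset[OF lowdegD(1)] by simp
  show "S \<in> lowdeg n (Suc k) \<union> insert n ` lowdeg n k"
  proof (cases "n \<in> S")
    case True
    have "S - {n} \<in> lowdeg n k" using S True fS by (auto simp: lowdeg_def)
    moreover have "S = insert n (S - {n})" using True by auto
    ultimately show ?thesis by blast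
  next
    case False
    thus ?thesis using S by (auto simp: lowdeg_def less_Suc_eq)
  qed
next
  fix S assume "S \<in> lowdeg n (Suc k) \<union> insert n ` lowdeg n k"
  thus "S \<in> lowdeg (Suc n) (Suc k)"
    by (auto simp: lowdeg_def less_Suc_eq intro!: card_insert_le_m1)
qed

lemma sum_lowdeg_Suc_Suc:
  "sum f (lowdeg (Suc n) (Suc k)) = sum f (lowdeg n (Suc k)) + (\<Sum>S\<in>lowdeg n k. f (insert n S))"
proof -
  have "inj_on (insert n) (lowdeg n k)"
  proof (rule inj_onI)
    fix S T assume "S \<in> lowdeg n k" "T \<in> lowdeg n k" and eq: "insert n S = insert n T"
    hence "n \<notin> S" "n \<notin> T" by (auto simp: lowdeg_def)
    thus "S = T" using eq by (rule insert_ident[THEN iffD1])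
  qed
  moreover have "lowdeg n (Suc k) \<inter> insert n ` lowdeg n k = {}"
    by (auto simp: lowdeg_def)
  ultimately show ?thesis
    unfolding lowdeg_Suc_Suc by (subst sum.union_disjoint) (auto simp: sum.reindex)
qed

lemma parseval_lowdeg:
  "unif_expect n (\<lambda>x. (\<Sum>S\<in>lowdeg n k. c S * chi S x)\<^sup>2) = (\<Sum>S\<in>lowdeg n k. (c S)\<^sup>2)"
proof -
  have "unif_expect n (\<lambda>x. (\<Sum>S\<in>lowdeg n k. c S * chi S x)\<^sup>2)
    = unif_expect n (\<lambda>x. \<Sum>S\<in>lowdeg n k. \<Sum>T\<in>lowdeg n k. c S * c T * (chi S x * chi T x))"
    by (simp add: power2_eq_square sum_product mult_ac)
  also have "\<dots> = (\<Sum>S\<in>lowdeg n k. \<Sum>T\<in>lowdeg n k. c S * c T * of_bool (S = T))"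
    by (simp add: unif_expect_chi_mult lowdegD)
  also have "\<dots> = (\<Sum>S\<in>lowdeg n k. (c S)\<^sup>2)"
    by (intro sum.cong refl) (simp add: of_bool_def if_distrib power2_eq_square cong: if_cong)
  finally show ?thesis .
qed

lemma fourier_coeff_lowdeg:
  assumes "T \<in> lowdeg n k"
  shows "fourier_coeff n (\<lambda>x. \<Sum>S\<in>lowdeg n k. c S * chi S x) T = c T"
proof -
  have "fourier_coeff n (\<lambda>x. \<Sum>S\<in>lowdeg n k. c S * chi S x) T
    = unif_expect n (\<lambda>x. \<Sum>S\<in>lowdeg n k. c S * (chi S x * chi T x))"
    by (simp add: fourier_coeff_chi sum_distrib_right mult.assoc del: unif_expect_sum_commute unif_expect_cmult)
  also have "\<dots> = (\<Sum>S\<in>lowdeg n k. c S * of_bool (S = T))"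
    using assms by (simp add: unif_expect_chi_mult lowdegD)
  also have "\<dots> = c T" using assms by (simp add: of_bool_def if_distrib cong: if_cong)
  finally show ?thesis .
qed

text \<open>The squared \<open>L\<^sup>2\<close> distance from \<open>g\<close> to its low-degree
  part \<open>f\<close> is nonnegative and equals the difference of the two sides.\<close>

lemma bessel_lowdeg: "(\<Sum>S\<in>lowdeg n k. (fourier_coeff n g S)\<^sup>2) \<le> unif_expect n (\<lambda>x. (g x)\<^sup>2)"
proof -
  define c where "c = fourier_coeff n g"
  define f where "f x = (\<Sum>S\<in>lowdeg n k. c S * chi S x)" for x
  have "unif_expect n (\<lambda>x. g x * f x) = unif_expect n (\<lambda>x. \<Sum>S\<in>lowdeg n k. c S * (g x * chi S x))"
    by (simp add: f_def sum_distrib_left mult_ac)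
  hence gf: "unif_expect n (\<lambda>x. g x * f x) = (\<Sum>S\<in>lowdeg n k. (c S)\<^sup>2)"
    by (simp add: c_def fourier_coeff_chi power2_eq_square)
  have ff: "unif_expect n (\<lambda>x. (f x)\<^sup>2) = (\<Sum>S\<in>lowdeg n k. (c S)\<^sup>2)"
    unfolding f_def by (rule parseval_lowdeg)
  have "0 \<le> unif_expect n (\<lambda>x. (g x - f x)\<^sup>2)"
    using unif_expect_mono[of n "\<lambda>_. 0" "\<lambda>x. (g x - f x)\<^sup>2"] by simp
  also have "\<dots> = unif_expect n (\<lambda>x. (g x)\<^sup>2 + (f x)\<^sup>2 - 2 * (g x * f x))"
    by (simp add: power2_diff mult.assoc)
  also have "\<dots> = unif_expect n (\<lambda>x. (g x)\<^sup>2) - (\<Sum>S\<in>lowdeg n k. (c S)\<^sup>2)"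
    by (simp add: gf ff)
  finally show ?thesis by (simp add: c_def)
qed

text \<open>Induction on the dimension: the polynomial splits as \<open>g + x n * h\<close>, where
  \<open>h\<close> has degree one less. Averaging over the sign of \<open>x n\<close> removes the
  odd powers of \<open>h\<close>, leaving \<open>g^4 + 6 * g^2 * h^2 + h^4\<close>.\<close>

theorem bonami_fourth_moment:
  "unif_expect n (\<lambda>x. (\<Sum>S\<in>lowdeg n k. c S * chi S x) ^ 4) \<le> 9 ^ k * (\<Sum>S\<in>lowdeg n k. (c S)\<^sup>2)\<^sup>2"
proof (induction n arbitrary: k c)
  case 0
  have "(c {}) ^ 4 \<le> 9 ^ k * (c {}) ^ 4" by (simp add: mult_le_cancel_right1)
  thus ?case by (simp add: lowdeg_0_left flip: power_mult)
next
  case (Suc n)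
  show ?case
  proof (cases k)
    case 0
    thus ?thesis by (simp add: lowdeg_0_right flip: power_mult)
  next
    case (Suc k')
    define g where "g x = (\<Sum>S\<in>lowdeg n k. c S * chi S x)" for x
    define h where "h x = (\<Sum>S\<in>lowdeg n k'. c (insert n S) * chi S x)" for x
    define G where "G = (\<Sum>S\<in>lowdeg n k. (c S)\<^sup>2)"
    define H where "H = (\<Sum>S\<in>lowdeg n k'. (c (insert n S))\<^sup>2)"
    let ?U = "unif_expect n"
    have GH: "G \<ge> 0" "H \<ge> 0" by (auto simp: G_def H_def intro!: sum_nonneg)
    have g4: "?U (\<lambda>x. g x ^ 4) \<le> 9 ^ k * G\<^sup>2" unfolding g_def G_def by (rule Suc.IH)
    have h4: "?U (\<lambda>x. h x ^ 4) \<le> 9 ^ k' * H\<^sup>2" unfolding h_def H_def by (rule Suc.IH)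
    have f: "(\<Sum>S\<in>lowdeg (Suc n) k. c S * chi S (x(n := s))) = g x + s * h x" for x s
      unfolding Suc sum_lowdeg_Suc_Suc g_def h_def
      by (simp add: chi_upd chi_insert_upd lowdegD sum_distrib_left mult_ac)
    have "unif_expect (Suc n) (\<lambda>x. (\<Sum>S\<in>lowdeg (Suc n) k. c S * chi S x) ^ 4)
      = ?U (\<lambda>x. ((g x + h x) ^ 4 + (g x - h x) ^ 4) / 2)"
      unfolding unif_expect_Suc f by simp
    also have "\<dots> = ?U (\<lambda>x. g x ^ 4 + 6 * ((g x)\<^sup>2 * (h x)\<^sup>2) + h x ^ 4)"
      by (intro unif_expect_cong) (simp add: power4_eq_xxxx power2_eq_square algebra_simps)
    also have "\<dots> = ?U (\<lambda>x. g x ^ 4) + 6 * ?U (\<lambda>x. (g x)\<^sup>2 * (h x)\<^sup>2) + ?U (\<lambda>x. h x ^ 4)"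
      by simp
    \<comment> \<open>Cauchy-Schwarz and both induction hypotheses give the geometric mean of
      \<open>9 ^ k\<close> and \<open>9 ^ k'\<close>, that is \<open>3 * 9 ^ k'\<close>. Then 6 * 3
      = 2 * 9 is exactly the cross coefficient needed to complete the square
      \<open>(G + H)\<^sup>2\<close>.\<close>
    also have "?U (\<lambda>x. (g x)\<^sup>2 * (h x)\<^sup>2) \<le> 3 * 9 ^ k' * (G * H)"
    proof (rule power2_le_imp_le)
      have "(?U (\<lambda>x. (g x)\<^sup>2 * (h x)\<^sup>2))\<^sup>2 \<le> ?U (\<lambda>x. g x ^ 4) * ?U (\<lambda>x. h x ^ 4)"
        using unif_expect_Cauchy_Schwarz[of n "\<lambda>x. (g x)\<^sup>2" "\<lambda>x. (h x)\<^sup>2"] by (simp flip: power_mult)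
      also have "\<dots> \<le> (9 ^ k * G\<^sup>2) * (9 ^ k' * H\<^sup>2)"
        using unif_expect_mono[of n "\<lambda>_. 0" "\<lambda>x. h x ^ 4"] by (intro mult_mono g4 h4) auto
      also have "\<dots> = (3 * 9 ^ k' * (G * H))\<^sup>2" by (simp add: Suc power_mult_distrib power2_eq_square mult_ac)
      finally show "(?U (\<lambda>x. (g x)\<^sup>2 * (h x)\<^sup>2))\<^sup>2 \<le> (3 * 9 ^ k' * (G * H))\<^sup>2" .
    qed (use GH in simp)
    finally have "unif_expect (Suc n) (\<lambda>x. (\<Sum>S\<in>lowdeg (Suc n) k. c S * chi S x) ^ 4)
       \<le> 9 ^ k * G\<^sup>2 + 6 * (3 * 9 ^ k' * (G * H)) + 9 ^ k' * H\<^sup>2" using g4 h4 by linarith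
    also have "\<dots> \<le> 9 ^ k * G\<^sup>2 + 6 * (3 * 9 ^ k' * (G * H)) + 9 ^ k * H\<^sup>2"
      unfolding Suc by (intro add_left_mono mult_right_mono) auto
    also have "\<dots> = 9 ^ k * (G + H)\<^sup>2"
      by (simp add: Suc power2_eq_square algebra_simps)
    also have "G + H = (\<Sum>S\<in>lowdeg (Suc n) k. (c S)\<^sup>2)"
      unfolding Suc sum_lowdeg_Suc_Suc G_def H_def by simp
    finally show ?thesis .
  qed
qed

lemma fourier_coeff_diff: "fourier_coeff n (\<lambda>x. f x - g x) S = fourier_coeff n f S - fourier_coeff n g S"
  by (simp add: fourier_coeff_chi left_diff_distrib)

lemma fourier_coeff_add: "fourier_coeff n (\<lambda>x. f x + g x) S = fourier_coeff n f S + fourier_coeff n g S"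
  by (simp add: fourier_coeff_chi distrib_right)

subsection \<open>Distance to k-wise uniformity\<close>

text \<open>Truncate the polynomial with coefficients \<open>v\<close> at height \<open>2 * 3^k * s\<close>; by the fourth-moment bound
  the error has \<open>L\<^sup>2\<close> norm at most \<open>s/2\<close>.\<close>

lemma bounded_lift_step:
  assumes s: "s \<ge> 0" and v: "(\<Sum>S\<in>lowdeg n k. (v S)\<^sup>2) \<le> s\<^sup>2"
  shows "\<exists>g. (\<forall>x. \<bar>g x\<bar> \<le> 2 * 3 ^ k * s) \<and> (\<Sum>S\<in>lowdeg n k. (v S - fourier_coeff n g S)\<^sup>2) \<le> (s / 2)\<^sup>2"
proof (cases "s = 0")
  case True
  thus ?thesis using v by (intro exI[of _ "\<lambda>_. 0"]) (simp add: fourier_coeff_chi)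
next
  case False
  define a where "a = 2 * 3 ^ k * s"
  have a: "a > 0" using s False by (simp add: a_def)
  define f where "f x = (\<Sum>S\<in>lowdeg n k. v S * chi S x)" for x
  define g where "g x = max (-a) (min a (f x))" for x
  have "(\<Sum>S\<in>lowdeg n k. (v S - fourier_coeff n g S)\<^sup>2) = (\<Sum>S\<in>lowdeg n k. (fourier_coeff n (\<lambda>x. f x - g x) S)\<^sup>2)"
    by (intro sum.cong refl) (simp add: fourier_coeff_diff f_def fourier_coeff_lowdeg)
  also have "\<dots> \<le> unif_expect n (\<lambda>x. (f x - g x)\<^sup>2)" by (rule bessel_lowdeg)
  \<comment> \<open>Beyond the truncation height the error is at most \<open>(f x)\<^sup>2\<close>,
    which there is at most \<open>f x ^ 4 / a\<^sup>2\<close>. The factor \<open>3 ^ k\<close> in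
    \<open>a\<close> cancels Bonami's \<open>9 ^ k\<close>, and the factor 2 yields the
    halving.\<close>
  also have "\<dots> \<le> unif_expect n (\<lambda>x. f x ^ 4 / a\<^sup>2)"
  proof (rule unif_expect_mono)
    fix x
    show "(f x - g x)\<^sup>2 \<le> f x ^ 4 / a\<^sup>2"
    proof (cases "\<bar>f x\<bar> \<le> a")
      case True
      hence "g x = f x" by (auto simp: g_def)
      thus ?thesis by simp
    next
      case False
      have "(f x - g x)\<^sup>2 \<le> (f x)\<^sup>2"
        using False a by (auto simp: g_def abs_le_square_iff[symmetric])
      also have "a\<^sup>2 \<le> (f x)\<^sup>2" using False a by (simp add: abs_le_square_iff[symmetric])
      hence "(f x)\<^sup>2 * a\<^sup>2 \<le> (f x)\<^sup>2 * (f x)\<^sup>2" by (intro mult_left_mono) auto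
      hence "(f x)\<^sup>2 \<le> f x ^ 4 / a\<^sup>2" using a by (simp add: field_simps flip: power_add)
      finally show ?thesis .
    qed
  qed
  also have "\<dots> \<le> (9 ^ k * (\<Sum>S\<in>lowdeg n k. (v S)\<^sup>2)\<^sup>2) / a\<^sup>2"
    unfolding unif_expect_divide f_def by (intro divide_right_mono bonami_fourth_moment) simp
  also have "\<dots> \<le> (9 ^ k * (s\<^sup>2)\<^sup>2) / a\<^sup>2"
    using v by (intro divide_right_mono mult_left_mono power_mono) (auto intro!: sum_nonneg)
  also have "\<dots> = (s / 2)\<^sup>2"
  proof -
    have "(9::real) ^ k = (3 ^ k)\<^sup>2" by (simp add: power2_eq_square flip: power_mult_distrib)
    thus ?thesis using False by (simp add: a_def power_mult_distrib field_simps power2_eq_square)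
  qed
  finally show ?thesis
    using a by (intro exI[of _ g]) (auto simp: g_def a_def[symmetric])
qed

text \<open>The previous step is applied to the remaining error, whose norm halves each time; the
  heights form a geometric series with sum \<open>4 * 3 ^ k * s\<close>.\<close>

lemma bounded_lift_iterate:
  assumes s: "s \<ge> 0" and v: "(\<Sum>S\<in>lowdeg n k. (v S)\<^sup>2) \<le> s\<^sup>2"
  shows "\<exists>g. (\<forall>x. \<bar>g x\<bar> \<le> 4 * 3 ^ k * s * (1 - 1 / 2 ^ j)) \<and>
    (\<Sum>S\<in>lowdeg n k. (v S - fourier_coeff n g S)\<^sup>2) \<le> (s / 2 ^ j)\<^sup>2"
proof (induction j)
  case 0
  show ?case using v by (intro exI[of _ "\<lambda>_. 0"]) (simp add: fourier_coeff_chi)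
next
  case (Suc j)
  then obtain g where g: "\<And>x. \<bar>g x\<bar> \<le> 4 * 3 ^ k * s * (1 - 1 / 2 ^ j)"
    "(\<Sum>S\<in>lowdeg n k. (v S - fourier_coeff n g S)\<^sup>2) \<le> (s / 2 ^ j)\<^sup>2" by blast
  have "s / 2 ^ j \<ge> 0" using s by simp
  from bounded_lift_step[OF this g(2)] obtain h where h: "\<And>x. \<bar>h x\<bar> \<le> 2 * 3 ^ k * (s / 2 ^ j)"
    "(\<Sum>S\<in>lowdeg n k. (v S - fourier_coeff n g S - fourier_coeff n h S)\<^sup>2) \<le> (s / 2 ^ j / 2)\<^sup>2" by blast
  show ?case
  proof (intro exI[of _ "\<lambda>x. g x + h x"] conjI allI)
    fix x
    have "\<bar>g x + h x\<bar> \<le> 4 * 3 ^ k * s * (1 - 1 / 2 ^ j) + 2 * 3 ^ k * (s / 2 ^ j)"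
      using g(1)[of x] h(1)[of x] by linarith
    also have "\<dots> = 4 * 3 ^ k * s * (1 - 1 / 2 ^ Suc j)" by (simp add: field_simps)
    finally show "\<bar>g x + h x\<bar> \<le> 4 * 3 ^ k * s * (1 - 1 / 2 ^ Suc j)" .
  qed (use h(2) in \<open>simp add: fourier_coeff_add diff_diff_eq mult.commute\<close>)
qed

text \<open>After finitely many rounds the error polynomial is added exactly instead of passing to a
  limit. Once \<open>2 ^ j\<close> reaches the number of characters, its sup norm on the cube is at
  most \<open>s\<close>, which accounts for 5 = 4 + 1.\<close>

lemma bounded_lift:
  assumes s: "s \<ge> 0" and v: "(\<Sum>S\<in>lowdeg n k. (v S)\<^sup>2) \<le> s\<^sup>2"
  obtains g where "\<And>x. x \<in> cube n \<Longrightarrow> \<bar>g x\<bar> \<le> 5 * 3 ^ k * s"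
    "\<And>S. S \<in> lowdeg n k \<Longrightarrow> fourier_coeff n g S = v S"
proof -
  obtain j where j: "real (card (lowdeg n k)) \<le> 2 ^ j"
    by (metis less_imp_le of_nat_less_two_power of_nat_le_iff of_nat_numeral of_nat_power real_arch_pow one_less_numeral_iff semiring_norm(76))
  from bounded_lift_iterate[OF s v, of j] obtain g where
    g: "\<And>x. \<bar>g x\<bar> \<le> 4 * 3 ^ k * s * (1 - 1 / 2 ^ j)"
    "(\<Sum>S\<in>lowdeg n k. (v S - fourier_coeff n g S)\<^sup>2) \<le> (s / 2 ^ j)\<^sup>2" by blast
  define r where "r x = (\<Sum>S\<in>lowdeg n k. (v S - fourier_coeff n g S) * chi S x)" for x
  show ?thesis
  proof (rule that[of "\<lambda>x. g x + r x"])
    fix S assume "S \<in> lowdeg n k"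
    thus "fourier_coeff n (\<lambda>x. g x + r x) S = v S"
      by (simp add: fourier_coeff_add r_def fourier_coeff_lowdeg)
  next
    fix x assume x: "x \<in> cube n"
    have each: "\<bar>v S - fourier_coeff n g S\<bar> \<le> s / 2 ^ j" if "S \<in> lowdeg n k" for S
    proof -
      have "(v S - fourier_coeff n g S)\<^sup>2 \<le> (\<Sum>S\<in>lowdeg n k. (v S - fourier_coeff n g S)\<^sup>2)"
        using that by (intro member_le_sum) auto
      also note g(2)
      finally show ?thesis using s by (simp add: abs_le_square_iff[symmetric])
    qed
    have "\<bar>r x\<bar> \<le> (\<Sum>S\<in>lowdeg n k. \<bar>(v S - fourier_coeff n g S) * chi S x\<bar>)"
      unfolding r_def by (rule sum_abs)
    also have "\<dots> \<le> (\<Sum>S\<in>lowdeg n k. s / 2 ^ j)"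
      using each by (intro sum_mono) (simp add: abs_mult abs_chi[OF x] lowdegD)
    also have "\<dots> = real (card (lowdeg n k)) * (s / 2 ^ j)" by simp
    also have "\<dots> \<le> 2 ^ j * (s / 2 ^ j)" using j s by (intro mult_right_mono) auto
    also have "\<dots> = s" by simp
    also have "\<dots> \<le> 3 ^ k * s" using s by (simp add: mult_le_cancel_right1)
    finally have "\<bar>r x\<bar> \<le> 3 ^ k * s" .
    moreover have "\<bar>g x\<bar> \<le> 4 * 3 ^ k * s"
    proof -
      have "4 * 3 ^ k * s * (1 - 1 / 2 ^ j) \<le> 4 * 3 ^ k * s * 1" using s by (intro mult_left_mono) auto
      thus ?thesis using g(1)[of x] by linarith
    qed
    ultimately show "\<bar>g x + r x\<bar> \<le> 5 * 3 ^ k * s" by linarith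
  qed
qed

text \<open>If the low-degree weight were small, adding a small bounded function that cancels the
  low-degree coefficients, and a constant that restores nonnegativity, would give a nearby \<open>k\<close>-wise
  uniform density. Deleting the set \<open>B\<close> costs only its mass.\<close>

theorem far_imp_low_degree_weight:
  assumes \<phi>: "is_density n \<phi>" and far: "far_from_wise_uniform n \<delta> (real k) \<phi>"
    and \<delta>: "\<delta> > 0" and B: "unif_expect n (\<lambda>x. \<phi> x * of_bool (x \<in> B)) \<le> \<delta> / 2"
  shows "\<delta>\<^sup>2 / (225 * 9 ^ k) \<le> (\<Sum>S\<in>lowdeg n k - {{}}. (fourier_coeff n (\<lambda>x. \<phi> x * of_bool (x \<notin> B)) S)\<^sup>2)"
proof -
  let ?U = "unif_expect n"
  define \<phi>' where "\<phi>' x = \<phi> x * of_bool (x \<notin> B)" for x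
  define c where "c = fourier_coeff n \<phi>'"
  define W where "W = (\<Sum>S\<in>lowdeg n k - {{}}. (c S)\<^sup>2)"
  define s where "s = sqrt W"
  \<comment> \<open>The correction cancels every coefficient on levels \<open>1..k\<close>; the
    value 0 at the empty set keeps its mean zero.\<close>
  define v where "v S = (if S = {} then 0 else - c S)" for S
  define \<beta> where "\<beta> = ?U (\<lambda>x. \<phi> x * of_bool (x \<in> B))"
  define \<eta> where "\<eta> = 5 * 3 ^ k * s"
  have \<phi>0: "\<phi> x \<ge> 0" if "x \<in> cube n" for x using \<phi> that by (simp add: is_density_def)
  have \<phi>1: "?U \<phi> = 1" using \<phi> by (simp add: is_density_def)
  have W0: "W \<ge> 0" unfolding W_def by (intro sum_nonneg) auto
  have s0: "s \<ge> 0" "s\<^sup>2 = W" using W0 by (auto simp: s_def)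
  have \<eta>0: "\<eta> \<ge> 0" using s0 by (simp add: \<eta>_def)
  have \<beta>0: "\<beta> \<ge> 0"
    unfolding \<beta>_def using unif_expect_mono[of n "\<lambda>_. 0" "\<lambda>x. \<phi> x * of_bool (x \<in> B)"] \<phi>0 by simp
  have U\<phi>': "?U \<phi>' = 1 - \<beta>"
  proof -
    have "?U \<phi>' + \<beta> = ?U (\<lambda>x. \<phi>' x + \<phi> x * of_bool (x \<in> B))" by (simp add: \<beta>_def)
    also have "\<dots> = ?U \<phi>" by (intro unif_expect_cong) (simp add: \<phi>'_def)
    finally show ?thesis using \<phi>1 by simp
  qed
  have "(\<Sum>S\<in>lowdeg n k. (v S)\<^sup>2) = (\<Sum>S\<in>lowdeg n k - {{}}. (v S)\<^sup>2)"
    by (subst sum.remove[of _ "{}"]) (auto simp: v_def)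
  also have "\<dots> = W" unfolding W_def by (intro sum.cong) (auto simp: v_def)
  finally have vW: "(\<Sum>S\<in>lowdeg n k. (v S)\<^sup>2) \<le> s\<^sup>2" by (simp add: s0)
  obtain g where g: "\<And>x. x \<in> cube n \<Longrightarrow> \<bar>g x\<bar> \<le> \<eta>" "\<And>S. S \<in> lowdeg n k \<Longrightarrow> fourier_coeff n g S = v S"
    using bounded_lift[OF s0(1) vW] unfolding \<eta>_def by metis
  have Ug: "?U g = 0" using g(2)[of "{}"] by (simp add: fourier_coeff_chi v_def)
  \<comment> \<open>The constant \<beta> restores the deleted mass, \<eta> dominates the correction
    \<open>g\<close> and so ensures nonnegativity, and the denominator renormalises the total mass
    \<open>1 + \<eta>\<close>.\<close>
  define \<psi> where "\<psi> x = (\<phi>' x + (\<beta> + \<eta>) + g x) / (1 + \<eta>)" for x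
  have "is_density n \<psi>"
    unfolding is_density_def
  proof (intro conjI ballI)
    fix x assume x: "x \<in> cube n"
    have "\<phi>' x \<ge> 0" using \<phi>0[OF x] by (simp add: \<phi>'_def)
    thus "\<psi> x \<ge> 0" unfolding \<psi>_def using g(1)[OF x] \<eta>0 \<beta>0 by (intro divide_nonneg_nonneg) auto
  next
    show "?U \<psi> = 1" unfolding \<psi>_def using \<eta>0 by (simp add: U\<phi>' Ug)
  qed
  moreover have "wise_uniform n (real k) \<psi>"
    unfolding wise_uniform_def
  proof (intro allI impI)
    fix S assume S: "S \<subseteq> {..<n} \<and> 1 \<le> card S \<and> real (card S) \<le> real k"
    hence SL: "S \<in> lowdeg n k" "S \<noteq> {}" by (auto simp: lowdeg_def)
    have "fourier_coeff n \<psi> S = ?U (\<lambda>x. (\<phi>' x * chi S x + (\<beta> + \<eta>) * chi S x + g x * chi S x) / (1 + \<eta>))"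
      unfolding fourier_coeff_chi \<psi>_def by (simp add: distrib_right)
    also have "\<dots> = (c S + (\<beta> + \<eta>) * ?U (chi S) + fourier_coeff n g S) / (1 + \<eta>)"
      by (simp add: c_def fourier_coeff_chi distrib_right)
    also have "\<dots> = 0" using S SL g(2)[OF SL(1)] by (simp add: unif_expect_chi v_def)
    finally show "fourier_coeff n \<psi> S = 0" .
  qed
  ultimately have "\<delta> < tv_dist n \<phi> \<psi>" using far by (simp add: far_from_wise_uniform_def)
  also have "?U (\<lambda>x. \<bar>\<phi> x - \<psi> x\<bar>) \<le> ?U (\<lambda>x. \<phi> x * of_bool (x \<in> B) + \<eta> * \<phi> x + (\<beta> + 2 * \<eta>))"
  proof (rule unif_expect_mono)
    fix x assume x: "x \<in> cube n"
    have "\<phi> x - \<psi> x = (\<phi> x * of_bool (x \<in> B) + \<eta> * \<phi> x - (\<beta> + \<eta>) - g x) / (1 + \<eta>)"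
      using \<eta>0 by (simp add: \<psi>_def \<phi>'_def field_simps)
    also have "\<bar>\<dots>\<bar> = \<bar>\<phi> x * of_bool (x \<in> B) + \<eta> * \<phi> x - (\<beta> + \<eta>) - g x\<bar> / (1 + \<eta>)"
      using \<eta>0 by simp
    also have "\<dots> \<le> \<bar>\<phi> x * of_bool (x \<in> B) + \<eta> * \<phi> x - (\<beta> + \<eta>) - g x\<bar>"
      using \<eta>0 by (simp add: divide_le_eq mult_le_cancel_left1)
    also have "\<dots> \<le> \<phi> x * of_bool (x \<in> B) + \<eta> * \<phi> x + (\<beta> + 2 * \<eta>)"
    proof -
      have "0 \<le> \<phi> x * of_bool (x \<in> B)" "0 \<le> \<eta> * \<phi> x" using \<phi>0[OF x] \<eta>0 by auto
      thus ?thesis using g(1)[OF x] \<beta>0 \<eta>0 by linarith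
    qed
    finally show "\<bar>\<phi> x - \<psi> x\<bar> \<le> \<phi> x * of_bool (x \<in> B) + \<eta> * \<phi> x + (\<beta> + 2 * \<eta>)" .
  qed
  hence "tv_dist n \<phi> \<psi> \<le> \<beta> + 3 / 2 * \<eta>"
    by (simp add: tv_dist_def \<phi>1 flip: \<beta>_def)
  finally have "\<delta> < \<beta> + 3 / 2 * \<eta>" .
  \<comment> \<open>Deleting \<open>B\<close> uses up at most half of \<delta>, so \<delta> is at
    most 3 * \<eta>; squaring gives the constant 225 = 15 * 15.\<close>
  hence "\<delta> / 2 \<le> 3 / 2 * \<eta>" using B unfolding \<beta>_def[symmetric] by linarith
  hence "\<delta> \<le> 15 * 3 ^ k * s" by (simp add: \<eta>_def)
  hence "\<delta>\<^sup>2 \<le> (15 * 3 ^ k * s)\<^sup>2" using \<delta> by (intro power_mono) auto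
  also have "\<dots> = 225 * 9 ^ k * W"
  proof -
    have "(9::real) ^ k = (3 ^ k)\<^sup>2" by (simp add: power2_eq_square flip: power_mult_distrib)
    thus ?thesis by (simp add: power_mult_distrib s0)
  qed
  finally show ?thesis by (simp add: W_def c_def \<phi>'_def[abs_def] field_simps)
qed

subsection \<open>The tester\<close>

lemma pmf_density_pmf:
  assumes "is_density n \<phi>"
  shows "pmf (density_pmf n \<phi>) x = (if x \<in> cube n then \<phi> x / 2 ^ n else 0)"
  unfolding density_pmf_def
proof (rule pmf_embed_pmf)
  let ?f = "\<lambda>x. if x \<in> cube n then \<phi> x / 2 ^ n else 0"
  have nonneg: "0 \<le> ?f x" for x using assms by (simp add: is_density_def)
  have "(\<integral>\<^sup>+x. ennreal (?f x) \<partial>count_space UNIV) = (\<Sum>x\<in>cube n. ennreal (?f x))"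
    by (rule nn_integral_count_space') auto
  also have "\<dots> = ennreal (\<Sum>x\<in>cube n. ?f x)" by (rule sum_ennreal) (rule nonneg)
  also have "(\<Sum>x\<in>cube n. ?f x) = unif_expect n \<phi>"
    by (simp add: unif_expect_sum sum_divide_distrib)
  finally show "(\<integral>\<^sup>+x. ennreal (?f x) \<partial>count_space UNIV) = 1" using assms by (simp add: is_density_def)
qed (use assms in \<open>simp add: is_density_def\<close>)

lemma set_density_pmf: "is_density n \<phi> \<Longrightarrow> set_pmf (density_pmf n \<phi>) \<subseteq> cube n"
  by (auto simp: set_pmf_eq pmf_density_pmf split: if_splits)

lemma finite_density_pmf: "is_density n \<phi> \<Longrightarrow> finite (set_pmf (density_pmf n \<phi>))"
  using finite_subset[OF set_density_pmf] by simp

lemma expectation_density_pmf: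
  assumes "is_density n \<phi>"
  shows "measure_pmf.expectation (density_pmf n \<phi>) f = unif_expect n (\<lambda>x. \<phi> x * f x)"
  using set_density_pmf[OF assms]
  by (subst integral_measure_pmf_real[of "cube n"])
     (auto simp: unif_expect_sum pmf_density_pmf[OF assms] sum_divide_distrib mult.commute)

section \<open>Moments of the character kernel under \<open>4k\<close>-wise uniformity\<close>

lemma card_sdiff_le: "finite S \<Longrightarrow> finite T \<Longrightarrow> card ((S - T) \<union> (T - S)) \<le> card S + card T"
  by (meson Diff_subset add_mono card_Un_le card_mono order_trans)

text \<open>A product of four characters of degree at most \<open>k\<close> is a character of degree
  at most \<open>4 * k\<close>. The right-hand side is free of \<phi>, so fourth moments under
  different such densities can be compared.\<close>

lemma quartic_moment_eq:
  assumes \<phi>: "\<And>A. A \<subseteq> {..<n} \<Longrightarrow> card A \<le> 4 * k \<Longrightarrow> fourier_coeff n \<phi> A = of_bool (A = {})"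
  defines "sd \<equiv> \<lambda>S T. (S - T) \<union> (T - S)"
  shows "unif_expect n (\<lambda>x. \<phi> x * (\<Sum>S\<in>lowdeg n k. c S * chi S x) ^ 4) =
    (\<Sum>S\<in>lowdeg n k. \<Sum>T\<in>lowdeg n k. \<Sum>V\<in>lowdeg n k. \<Sum>W\<in>lowdeg n k.
      (c S * c T * (c V * c W)) * of_bool (sd (sd S T) (sd V W) = {}))"
proof -
  let ?L = "lowdeg n k"
  have sq: "(\<Sum>S\<in>?L. c S * chi S x)\<^sup>2 = (\<Sum>S\<in>?L. \<Sum>T\<in>?L. (c S * c T) * chi (sd S T) x)" if x: "x \<in> cube n" for x
    unfolding power2_eq_square sum_product sd_def
    by (intro sum.cong refl) (simp add: chi_mult[OF x, symmetric] lowdegD mult_ac)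
  have sub: "sd S T \<subseteq> {..<n}" if "S \<subseteq> {..<n}" "T \<subseteq> {..<n}" for S T using that by (auto simp: sd_def)
  have cd: "card (sd S T) \<le> card S + card T" if "S \<subseteq> {..<n}" "T \<subseteq> {..<n}" for S T
    unfolding sd_def using that finite_subset by (intro card_sdiff_le) auto
  have "unif_expect n (\<lambda>x. \<phi> x * (\<Sum>S\<in>?L. c S * chi S x) ^ 4) =
    unif_expect n (\<lambda>x. \<Sum>S\<in>?L. \<Sum>T\<in>?L. \<Sum>V\<in>?L. \<Sum>W\<in>?L. (c S * c T * (c V * c W)) * (\<phi> x * chi (sd (sd S T) (sd V W)) x))"
  proof (rule unif_expect_cong)
    fix x assume x: "x \<in> cube n"
    have "\<phi> x * (\<Sum>S\<in>?L. c S * chi S x) ^ 4 = \<phi> x * ((\<Sum>S\<in>?L. c S * chi S x)\<^sup>2 * (\<Sum>S\<in>?L. c S * chi S x)\<^sup>2)"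
      by (simp flip: power_add)
    also have "\<dots> = (\<Sum>S\<in>?L. \<Sum>T\<in>?L. \<Sum>V\<in>?L. \<Sum>W\<in>?L. \<phi> x * (((c S * c T) * chi (sd S T) x) * ((c V * c W) * chi (sd V W) x)))"
      unfolding sq[OF x] unfolding sum_distrib_right unfolding sum_distrib_left ..
    also have "\<dots> = (\<Sum>S\<in>?L. \<Sum>T\<in>?L. \<Sum>V\<in>?L. \<Sum>W\<in>?L. (c S * c T * (c V * c W)) * (\<phi> x * chi (sd (sd S T) (sd V W)) x))"
    proof (intro sum.cong refl)
      fix S T V W assume "S \<in> ?L" "T \<in> ?L" "V \<in> ?L" "W \<in> ?L"
      hence "chi (sd S T) x * chi (sd V W) x = chi (sd (sd S T) (sd V W)) x"
        using chi_mult[OF x sub sub] lowdegD(1) by (simp add: sd_def)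
      thus "\<phi> x * (((c S * c T) * chi (sd S T) x) * ((c V * c W) * chi (sd V W) x)) =
        (c S * c T * (c V * c W)) * (\<phi> x * chi (sd (sd S T) (sd V W)) x)"
        by (simp flip: \<open>chi (sd S T) x * chi (sd V W) x = _\<close>)
    qed
    finally show "\<phi> x * (\<Sum>S\<in>?L. c S * chi S x) ^ 4 = \<dots>" .
  qed
  also have "\<dots> = (\<Sum>S\<in>?L. \<Sum>T\<in>?L. \<Sum>V\<in>?L. \<Sum>W\<in>?L. (c S * c T * (c V * c W)) * fourier_coeff n \<phi> (sd (sd S T) (sd V W)))"
    by (simp add: fourier_coeff_chi)
  also have "\<dots> = (\<Sum>S\<in>?L. \<Sum>T\<in>?L. \<Sum>V\<in>?L. \<Sum>W\<in>?L. (c S * c T * (c V * c W)) * of_bool (sd (sd S T) (sd V W) = {}))"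
  proof (intro sum.cong refl)
    fix S T V W assume L: "S \<in> ?L" "T \<in> ?L" "V \<in> ?L" "W \<in> ?L"
    note s = L[THEN lowdegD(1)]
    have "card (sd (sd S T) (sd V W)) \<le> card (sd S T) + card (sd V W)" using s by (intro cd sub)
    also have "\<dots> \<le> (card S + card T) + (card V + card W)" using s by (intro add_mono cd)
    also have "\<dots> \<le> 4 * k" using L[THEN lowdegD(2)] by simp
    finally show "(c S * c T * (c V * c W)) * fourier_coeff n \<phi> (sd (sd S T) (sd V W)) =
       (c S * c T * (c V * c W)) * of_bool (sd (sd S T) (sd V W) = {})"
      using \<phi>[OF sub[OF sub[OF s(1,2)] sub[OF s(3,4)]]] by simp
  qed
  finally show ?thesis .
qed

text \<open>A set is coded by a list of length exactly \<open>k\<close> over \<open>{..n}\<close>,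
  in which the extra symbol \<open>n\<close> serves as padding.\<close>

lemma card_lowdeg_le: "card (lowdeg n k) \<le> (n + 1) ^ k"
proof -
  let ?X = "{xs. set xs \<subseteq> {..n} \<and> length xs = k}"
  have "lowdeg n k \<subseteq> (\<lambda>xs. set xs \<inter> {..<n}) ` ?X"
  proof
    fix S assume S: "S \<in> lowdeg n k"
    hence fS: "finite S" using finite_subset[OF lowdegD(1)] by simp
    let ?xs = "sorted_list_of_set S @ replicate (k - card S) n"
    have "set ?xs \<inter> {..<n} = S" using lowdegD(1)[OF S] fS by auto
    moreover have "x \<le> n" if "x \<in> set ?xs" for x
      using that lowdegD(1)[OF S] fS by (force simp: set_replicate_conv_if split: if_splits)
    hence "set ?xs \<subseteq> {..n}" by blast
    moreover have "length ?xs = k" using lowdegD(2)[OF S] by simp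
    ultimately have "?xs \<in> ?X" "S = set ?xs \<inter> {..<n}" by simp_all
    thus "S \<in> (\<lambda>xs. set xs \<inter> {..<n}) ` ?X" by (rule rev_image_eqI)
  qed
  hence "card (lowdeg n k) \<le> card ?X"
    by (rule surj_card_le[rotated]) (rule finite_lists_length_eq, simp)
  also have "\<dots> = (n + 1) ^ k" by (simp add: card_lists_length_eq)
  finally show ?thesis .
qed

definition char_kernel :: "nat \<Rightarrow> nat \<Rightarrow> point \<Rightarrow> point \<Rightarrow> real" where
  "char_kernel n k x y = (\<Sum>S\<in>lowdeg n k - {{}}. chi S x * chi S y)"

text \<open>The indicator moves the exclusion of the empty set into the coefficients, so that the
  results on full low-degree polynomials apply.\<close>

lemma char_kernel_lowdeg: "char_kernel n k y x = (\<Sum>S\<in>lowdeg n k. (chi S y * of_bool (S \<noteq> {})) * chi S x)"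
  unfolding char_kernel_def by (rule sum.mono_neutral_cong_left) simp_all

text \<open>For fixed \<open>y\<close> the kernel is a polynomial in \<open>x\<close> with
  coefficients 1 or -1, so \<open>N\<close> is its squared norm. The first two moments are read off
  the coefficients of \<phi>; the fourth is transferred to the uniform density and bounded there by
  Bonami.\<close>

lemma char_kernel_moments:
  assumes \<phi>: "is_density n \<phi>" and u: "wise_uniform n j \<phi>" and j: "4 * real k \<le> j" and y: "y \<in> cube n"
  defines "E \<equiv> measure_pmf.expectation (density_pmf n \<phi>)" and "N \<equiv> real (card (lowdeg n k - {{}}))"
  shows "E (char_kernel n k y) = 0" "E (\<lambda>x. (char_kernel n k y x)\<^sup>2) = N"
    "E (\<lambda>x. (char_kernel n k y x) ^ 4) \<le> 9 ^ k * N\<^sup>2"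
proof -
  let ?L = "lowdeg n k" and ?I = "lowdeg n k - {{}}"
  have fc: "fourier_coeff n \<phi> A = of_bool (A = {})" if "A \<subseteq> {..<n}" "card A \<le> 4 * k" for A
  proof (cases "A = {}")
    case True thus ?thesis using \<phi> by (simp add: fourier_coeff_chi is_density_def)
  next
    case False
    hence "card A \<ge> 1" using finite_subset[OF that(1)] by (simp add: Suc_leI card_gt_0_iff)
    moreover have "real (card A) \<le> j" using that(2) j by linarith
    ultimately show ?thesis using u that False by (auto simp: wise_uniform_def)
  qed
  have "E (char_kernel n k y) = unif_expect n (\<lambda>x. \<Sum>S\<in>?I. chi S y * (\<phi> x * chi S x))"
    by (simp add: E_def expectation_density_pmf[OF \<phi>] char_kernel_def[abs_def] sum_distrib_left mult_ac
      del: unif_expect_sum_commute)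
  also have "\<dots> = (\<Sum>S\<in>?I. chi S y * fourier_coeff n \<phi> S)" by (simp add: fourier_coeff_chi)
  also have "\<dots> = 0"
  proof (intro sum.neutral ballI)
    fix S assume S: "S \<in> ?I"
    hence "card S \<le> 4 * k" using lowdegD(2)[of S n k] by simp
    thus "chi S y * fourier_coeff n \<phi> S = 0" using S by (subst fc) (auto dest: lowdegD(1))
  qed
  finally show "E (char_kernel n k y) = 0" .
  have "E (\<lambda>x. (char_kernel n k y x)\<^sup>2) = unif_expect n (\<lambda>x. \<Sum>S\<in>?I. \<Sum>T\<in>?I. (chi S y * chi T y) * (\<phi> x * chi ((S - T) \<union> (T - S)) x))"
    unfolding E_def expectation_density_pmf[OF \<phi>]
  proof (rule unif_expect_cong)
    fix x assume x: "x \<in> cube n"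
    show "\<phi> x * (char_kernel n k y x)\<^sup>2 = (\<Sum>S\<in>?I. \<Sum>T\<in>?I. (chi S y * chi T y) * (\<phi> x * chi ((S - T) \<union> (T - S)) x))"
      unfolding char_kernel_def power2_eq_square sum_product unfolding sum_distrib_left
      by (intro sum.cong refl) (simp add: chi_mult[OF x, symmetric] lowdegD(1)[of _ n k] mult_ac)
  qed
  also have "\<dots> = (\<Sum>S\<in>?I. \<Sum>T\<in>?I. (chi S y * chi T y) * fourier_coeff n \<phi> ((S - T) \<union> (T - S)))"
    by (simp add: fourier_coeff_chi)
  also have "\<dots> = (\<Sum>S\<in>?I. \<Sum>T\<in>?I. (chi S y * chi T y) * of_bool (S = T))"
  proof (intro sum.cong refl)
    fix S T assume "S \<in> ?I" "T \<in> ?I"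
    hence s: "S \<subseteq> {..<n}" "T \<subseteq> {..<n}" "card S \<le> k" "card T \<le> k" by (auto dest: lowdegD)
    have "card ((S - T) \<union> (T - S)) \<le> card S + card T"
      using s finite_subset by (intro card_sdiff_le) auto
    also have "\<dots> \<le> 4 * k" using s by simp
    finally have "fourier_coeff n \<phi> ((S - T) \<union> (T - S)) = of_bool ((S - T) \<union> (T - S) = {})"
      using s by (intro fc) auto
    also have "(S - T) \<union> (T - S) = {} \<longleftrightarrow> S = T" by auto
    finally show "(chi S y * chi T y) * fourier_coeff n \<phi> ((S - T) \<union> (T - S)) = (chi S y * chi T y) * of_bool (S = T)" by simp
  qed
  also have "\<dots> = (\<Sum>S\<in>?I. 1)"
  proof (intro sum.cong refl)
    fix S assume S: "S \<in> ?I"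
    have "(\<Sum>T\<in>?I. (chi S y * chi T y) * of_bool (S = T)) = chi S y * chi S y"
      using S by (simp add: of_bool_def if_distrib cong: if_cong)
    also have "\<dots> = 1" using S by (intro chi_square[OF y]) (auto dest: lowdegD)
    finally show "(\<Sum>T\<in>?I. (chi S y * chi T y) * of_bool (S = T)) = 1" .
  qed
  finally show "E (\<lambda>x. (char_kernel n k y x)\<^sup>2) = N" by (simp add: N_def)
  let ?c = "\<lambda>S. chi S y * of_bool (S \<noteq> {})"
  have "E (\<lambda>x. (char_kernel n k y x) ^ 4) = unif_expect n (\<lambda>x. \<phi> x * (\<Sum>S\<in>?L. ?c S * chi S x) ^ 4)"
    by (simp only: E_def expectation_density_pmf[OF \<phi>] char_kernel_lowdeg)
  \<comment> \<open>The density 1 is written out so that \<open>quartic_moment_eq\<close> applies to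
    it as well as to \<phi>.\<close>
  also have "\<dots> = unif_expect n (\<lambda>x. 1 * (\<Sum>S\<in>?L. ?c S * chi S x) ^ 4)"
  proof -
    have "fourier_coeff n (\<lambda>_. 1) A = of_bool (A = {})" if "A \<subseteq> {..<n}" for A
      using that by (simp add: fourier_coeff_chi unif_expect_chi)
    hence "unif_expect n (\<lambda>x. 1 * (\<Sum>S\<in>?L. ?c S * chi S x) ^ 4) = (\<Sum>S\<in>?L. \<Sum>T\<in>?L. \<Sum>V\<in>?L. \<Sum>W\<in>?L.
      (?c S * ?c T * (?c V * ?c W)) * of_bool (((S - T \<union> (T - S)) - (V - W \<union> (W - V))) \<union>
        ((V - W \<union> (W - V)) - (S - T \<union> (T - S))) = {}))"
      by (rule quartic_moment_eq)
    thus ?thesis using quartic_moment_eq[where c = ?c, OF fc] by simp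
  qed
  also have "\<dots> \<le> 9 ^ k * (\<Sum>S\<in>?L. (?c S)\<^sup>2)\<^sup>2"
    using bonami_fourth_moment[where c = ?c] by simp
  also have "(\<Sum>S\<in>?L. (?c S)\<^sup>2) = (\<Sum>S\<in>?I. (?c S)\<^sup>2)"
    by (subst sum.remove[of _ "{}"]) auto
  also have "\<dots> = (\<Sum>S\<in>?I. 1)"
    by (intro sum.cong refl) (auto simp: power2_eq_square dest!: lowdegD(1) intro!: chi_square[OF y])
  finally show "E (\<lambda>x. (char_kernel n k y x) ^ 4) \<le> 9 ^ k * N\<^sup>2" by (simp add: N_def)
qed

section \<open>The amplified tester and its parameters\<close>

lemma pmf_output_deterministic:
  "pmf (output_pmf n M (\<lambda>zs. return_pmf (b zs)) \<phi>) v =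
    measure_pmf.prob (replicate_pmf M (density_pmf n \<phi>)) {zs. b zs = v}"
  unfolding output_pmf_def map_pmf_def[symmetric] pmf_map
  by (rule arg_cong[of _ _ "measure_pmf.prob _"]) auto

lemma tests_mono:
  "tests n m A P Q \<Longrightarrow> (\<And>\<phi>. P' \<phi> \<Longrightarrow> P \<phi>) \<Longrightarrow> tests n m A P' Q"
  by (auto simp: tests_def)

lemma sqrt_power_eq_powr: "x > 0 \<Longrightarrow> sqrt (x ^ k) = x powr (real k / 2)"
  by (simp add: powr_half_sqrt[symmetric] powr_realpow[symmetric] powr_powr)

theorem uniformity_tester:
  fixes n k :: nat and \<delta> :: real
  assumes k: "k \<ge> 1" and n: "n \<ge> 1" and \<delta>: "0 < \<delta>" "\<delta> < 1"
  shows "\<exists>M A. real M \<le> 14929920000 ^ k * real n powr (real k / 2) * (1 / \<delta>\<^sup>2) \<and>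
    tests n M A (wise_uniform n (4 * real k)) (far_from_wise_uniform n \<delta> (real k))"
proof -
  define I where "I = lowdeg n k - {{}}"
  define N where "N = real (card I)"
  \<comment> \<open>The factor \<open>3 ^ k\<close> lets \<open>u\<^sup>2\<close> absorb Bonami's
    \<open>9 ^ k\<close> in the first check. The remaining constants are dictated by soundness, and
    \<open>w\<close> is the Fourier weight guaranteed for a far density after deleting a small
    set.\<close>
  define u :: real where "u = 60 * 3 ^ k"
  define D where "D = 256 * u"
  define w where "w = \<delta>\<^sup>2 / (225 * 9 ^ k)"
  define X where "X = D * sqrt N / w"
  define m where "m = nat \<lceil>X\<rceil>"
  define t where "t = sqrt (u\<^sup>2 * m * N / 24)"
  define q where "q = 12 * m * t\<^sup>2"
  \<comment> \<open>Truncation may halve the mean \<open>w\<close> and the lower tail bound loses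
    another factor 2, hence the quarter.\<close>
  define \<theta> where "\<theta> = m\<^sup>2 * w / 4"
  define a where "a zs = kernel_accepts t q \<theta> (char_kernel n k) (take m zs, drop m zs)" for zs
  define M where "M = 20 * (2 * m)"
  define A where "A zs = return_pmf (blocks_accept (2 * m) a 20 zs)" for zs
  have finI: "finite I" by (simp add: I_def)
  have "{0} \<in> I" using n k by (auto simp: I_def lowdeg_def)
  hence cI: "card I \<ge> 1" using finI by (metis One_nat_def Suc_leI card_gt_0_iff empty_iff)
  hence N1: "N \<ge> 1" by (simp add: N_def)
  have u60: "u \<ge> 60" by (simp add: u_def)
  have D1: "D \<ge> 15360" using u60 by (simp add: D_def)
  have d1: "\<delta>\<^sup>2 \<le> 1" using \<delta> by (simp add: power_le_one)
  have w0: "w > 0" using \<delta> by (simp add: w_def)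
  have wd: "w \<le> \<delta>\<^sup>2"
  proof -
    have "\<delta>\<^sup>2 * 1 \<le> \<delta>\<^sup>2 * (225 * 9 ^ k)" by (intro mult_left_mono) (auto intro: order_trans[OF one_le_power[of 9 k]])
    thus ?thesis by (simp add: w_def divide_le_eq)
  qed
  have w1: "w \<le> 1" using wd d1 by simp
  \<comment> \<open>With \<open>m\<close> at least \<open>1 / \<delta>\<close>, a set of mass at
    most \<open>1 / (8 * m)\<close> is light enough to be deleted in
    \<open>far_imp_low_degree_weight\<close>.\<close>
  have X_ge: "X \<ge> 1 / \<delta>"
  proof -
    have "1 / \<delta> \<le> 1 / w"
      using wd w0 \<delta> by (intro divide_left_mono) (auto simp: power2_eq_square intro: order_trans mult_left_le)
    also have "\<dots> \<le> D * sqrt N / w"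
      using D1 N1 w0 mult_mono[of 1 D 1 "sqrt N"] by (intro divide_right_mono) auto
    finally show ?thesis by (simp add: X_def)
  qed
  have X1: "X \<ge> 1" using X_ge \<delta> by (smt (verit) le_divide_eq_1_pos)
  have Xm: "X \<le> m" "m \<le> X + 1" using X1 unfolding m_def by linarith+
  have m1: "m \<ge> 1" using X1 Xm(1) by linarith
  have mpos: "real m > 0" using m1 by simp
  have t2: "t\<^sup>2 = u\<^sup>2 * m * N / 24" using N1 by (simp add: t_def)
  have t0: "t > 0" using u60 N1 mpos by (simp add: t_def)
  have q0: "q > 0" using t0 mpos by (simp add: q_def)
  have \<theta>0: "\<theta> > 0" using w0 mpos by (simp add: \<theta>_def)
  have bound: "real M \<le> 14929920000 ^ k * real n powr (real k / 2) * (1 / \<delta>\<^sup>2)"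
  proof -
    have "card I \<le> card (lowdeg n k)" unfolding I_def by (intro card_mono) auto
    also have "\<dots> \<le> (n + 1) ^ k" by (rule card_lowdeg_le)
    \<comment> \<open>Bounding \<open>n + 1\<close> by \<open>4 * n\<close> makes the square root of
      the constant exactly \<open>2 ^ k\<close>.\<close>
    also have "\<dots> \<le> (4 * n) ^ k" using n by (intro power_mono) auto
    finally have "N \<le> real ((4 * n) ^ k)" unfolding N_def by (simp only: of_nat_le_iff)
    hence "sqrt N \<le> sqrt ((4 * real n) ^ k)" by simp
    also have "\<dots> = 2 ^ k * sqrt (real n ^ k)"
      by (simp add: power_mult_distrib real_sqrt_mult real_sqrt_power)
    also have "\<dots> = 2 ^ k * real n powr (real k / 2)" using n by (simp add: sqrt_power_eq_powr)
    finally have sN: "sqrt N \<le> 2 ^ k * real n powr (real k / 2)" .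
    \<comment> \<open>Since \<open>X\<close> is at least 1, rounding up at most doubles it:
      \<open>40 * m\<close> is at most \<open>80 * X\<close>.\<close>
    have "real M \<le> 80 * X" using Xm X1 by (simp add: M_def)
    also have "\<dots> = (276480000 * (3 ^ k * 9 ^ k)) * sqrt N * (1 / \<delta>\<^sup>2)"
      using \<delta> by (simp add: X_def D_def u_def w_def power_mult_distrib)
    also have "\<dots> \<le> (276480000 * (3 ^ k * 9 ^ k)) * (2 ^ k * real n powr (real k / 2)) * (1 / \<delta>\<^sup>2)"
      by (intro mult_right_mono mult_left_mono sN) auto
    also have "\<dots> = (276480000 * (3 ^ k * 9 ^ k * 2 ^ k)) * real n powr (real k / 2) * (1 / \<delta>\<^sup>2)"
      by (simp only: mult_ac)
    also have "3 ^ k * 9 ^ k * 2 ^ k = (54 :: real) ^ k" by (simp flip: power_mult_distrib)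
    also have "(276480000 * 54 ^ k) * real n powr (real k / 2) * (1 / \<delta>\<^sup>2)
      \<le> (276480000 ^ k * 54 ^ k) * real n powr (real k / 2) * (1 / \<delta>\<^sup>2)"
      using self_le_power[of "276480000 :: real" k] k by (intro mult_right_mono) auto
    also have "\<dots> = 14929920000 ^ k * real n powr (real k / 2) * (1 / \<delta>\<^sup>2)"
      by (simp flip: power_mult_distrib)
    finally show ?thesis .
  qed
  have "tests n M A (wise_uniform n (4 * real k)) (far_from_wise_uniform n \<delta> (real k))"
    unfolding tests_def
  proof (intro allI impI conjI)
    fix \<phi> assume \<phi>: "is_density n \<phi>"
    define p where "p = density_pmf n \<phi>"
    note fin = finite_density_pmf[OF \<phi>, folded p_def]
    have supp: "x \<in> cube n" if "x \<in> set_pmf p" for x using set_density_pmf[OF \<phi>] that by (auto simp: p_def)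
    define P where "P = measure_pmf.prob (sample_pair m p) {z. kernel_accepts t q \<theta> (char_kernel n k) z}"
    have P01: "0 \<le> P" "P \<le> 1" by (simp_all add: P_def)
    have pr: "measure_pmf.prob (replicate_pmf M p) {zs. blocks_accept (2 * m) a 20 zs} = P ^ 20"
      unfolding M_def prob_blocks_accept[OF fin] P_def a_def prob_split_sample[OF fin] ..
    have T: "pmf (output_pmf n M A \<phi>) True = P ^ 20"
      using pr unfolding A_def[abs_def] pmf_output_deterministic p_def by simp
    have F: "pmf (output_pmf n M A \<phi>) False = 1 - P ^ 20"
      unfolding T[symmetric] using pmf_False_conv_True by metis
    {
      assume yes: "wise_uniform n (4 * real k) \<phi>"
      have "measure_pmf.prob (sample_pair m p) {z. \<not> kernel_accepts t q \<theta> (char_kernel n k) z}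
         \<le> (real m)\<^sup>2 * (9 ^ k * N\<^sup>2) / t ^ 4 + (real m)\<^sup>2 * N / q + (real m)\<^sup>2 * N / \<theta>\<^sup>2"
      proof (rule kernel_accepts_completeness[OF fin t0 q0 \<theta>0])
        fix y assume "y \<in> set_pmf p"
        hence "y \<in> cube n" by (rule supp)
        note mom = char_kernel_moments[OF \<phi> yes order_refl this, folded p_def I_def N_def]
        show "measure_pmf.expectation p (char_kernel n k y) = 0"
          "measure_pmf.expectation p (\<lambda>x. (char_kernel n k y x)\<^sup>2) = N"
          "measure_pmf.expectation p (\<lambda>x. char_kernel n k y x ^ 4) \<le> 9 ^ k * N\<^sup>2"
          by (fact mom)+
      qed (simp add: char_kernel_def mult.commute)
      also have "(real m)\<^sup>2 * (9 ^ k * N\<^sup>2) / t ^ 4 \<le> 1 / 1000"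
      proof -
        have "t ^ 4 = (t\<^sup>2)\<^sup>2" by simp
        also have "\<dots> = (u\<^sup>2 * m * N / 24)\<^sup>2" by (simp only: t2)
        finally have "(real m)\<^sup>2 * (9 ^ k * N\<^sup>2) / t ^ 4 = (real m)\<^sup>2 * (9 ^ k * N\<^sup>2) / (u\<^sup>2 * m * N / 24)\<^sup>2"
          by (simp only:)
        also have "\<dots> = 576 * 9 ^ k / (u\<^sup>2)\<^sup>2"
          using mpos N1 u60 by (simp add: field_simps power_mult_distrib)
        also have "u\<^sup>2 = 3600 * 9 ^ k"
          by (simp add: u_def power_mult_distrib power2_eq_square flip: power_mult_distrib)
        also have "576 * 9 ^ k / (3600 * 9 ^ k :: real)\<^sup>2 = (576 / 3600\<^sup>2) / 9 ^ k"
          by (simp add: field_simps power2_eq_square)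
        also have "\<dots> \<le> (576 / 3600\<^sup>2) / 1" by (intro divide_left_mono) auto
        finally show ?thesis by (simp add: power2_eq_square)
      qed
      also have "(real m)\<^sup>2 * N / q \<le> 1 / 1000"
      proof -
        have "(real m)\<^sup>2 * N / q = 2 / u\<^sup>2"
          unfolding q_def t2 using mpos N1 u60 by (simp add: field_simps power2_eq_square)
        also have "\<dots> \<le> 2 / 60\<^sup>2" using u60 by (intro divide_left_mono power_mono) auto
        finally show ?thesis by (simp add: power2_eq_square)
      qed
      also have "(real m)\<^sup>2 * N / \<theta>\<^sup>2 \<le> 1 / 1000"
      proof -
        have "D * sqrt N \<le> m * w" using Xm(1) w0 by (simp add: X_def field_simps)
        hence "(D * sqrt N)\<^sup>2 \<le> (m * w)\<^sup>2" using D1 N1 by (intro power_mono) auto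
        hence "D\<^sup>2 * N \<le> (m * w)\<^sup>2" using N1 by (simp add: power_mult_distrib)
        moreover have "15360\<^sup>2 \<le> D\<^sup>2" using D1 by (intro power_mono) auto
        hence "15360\<^sup>2 * N \<le> D\<^sup>2 * N" using N1 by (intro mult_right_mono) auto
        ultimately have "15360\<^sup>2 * N \<le> (m * w)\<^sup>2" by linarith
        hence *: "16 * N / (m * w)\<^sup>2 \<le> 1 / 1000"
          using mpos w0 N1 by (simp add: field_simps power_mult_distrib)
        have "(real m)\<^sup>2 * N / \<theta>\<^sup>2 = 16 * N / (m * w)\<^sup>2"
          using mpos w0 by (simp add: \<theta>_def field_simps power2_eq_square)
        thus ?thesis using * by simp
      qed
      finally have "measure_pmf.prob (sample_pair m p) {z. \<not> kernel_accepts t q \<theta> (char_kernel n k) z} \<le> 1 / 60"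
        by simp
      moreover have "measure_pmf.prob (sample_pair m p) {z. \<not> kernel_accepts t q \<theta> (char_kernel n k) z} = 1 - P"
        using measure_pmf.prob_compl[of "{z. kernel_accepts t q \<theta> (char_kernel n k) z}" "sample_pair m p"]
        by (simp add: P_def Compl_eq_Diff_UNIV[symmetric] Collect_neg_eq)
      ultimately have P: "P \<ge> 59 / 60" by simp
      \<comment> \<open>An error of 1/60 per block costs at most 20/60 = 1/3 over all 20
        blocks.\<close>
      have "2 / 3 = (1 + real 20 * (- 1 / 60))" by simp
      also have "\<dots> \<le> (1 + (- 1 / 60 :: real)) ^ 20" by (rule Bernoulli_inequality) simp
      also have "\<dots> \<le> P ^ 20" using P by (intro power_mono) auto
      finally show "2 / 3 \<le> pmf (output_pmf n M A \<phi>) True" unfolding T .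
    }
    {
      assume no: "far_from_wise_uniform n \<delta> (real k) \<phi>"
      interpret feature_kernel p I chi "char_kernel n k"
      proof
        fix S x assume "S \<in> I" "x \<in> set_pmf p"
        thus "\<bar>chi S x\<bar> \<le> 1" using abs_chi[OF supp lowdegD(1), of x S k] by (simp add: I_def)
      qed (simp_all add: fin finI char_kernel_def I_def)
      have "P \<le> 17 / 18"
        unfolding P_def q_def \<theta>_def
      proof (rule kernel_accepts_soundness[OF m1 cI u60 w0 w1 D_def _ t0])
        show "D * sqrt (real (card I)) / w \<le> real m" using Xm(1) by (simp add: X_def N_def)
        show "24 * t\<^sup>2 = u\<^sup>2 * real m * real (card I)" by (simp add: t2 N_def)
        fix B assume B: "measure_pmf.prob p B \<le> 1 / (8 * real m)"
        have "unif_expect n (\<lambda>x. \<phi> x * of_bool (x \<in> B)) = measure_pmf.prob p B"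
          unfolding prob_eq_expectation p_def expectation_density_pmf[OF \<phi>] ..
        also have "\<dots> \<le> 1 / (8 * real m)" by (rule B)
        also have "\<dots> \<le> \<delta> / 2"
        proof -
          have "1 / \<delta> \<le> m" using X_ge Xm by linarith
          thus ?thesis using \<delta> mpos by (simp add: field_simps)
        qed
        finally have "w \<le> (\<Sum>S\<in>I. (fourier_coeff n (\<lambda>x. \<phi> x * of_bool (x \<notin> B)) S)\<^sup>2)"
          unfolding w_def I_def by (rule far_imp_low_degree_weight[OF \<phi> no \<delta>(1)])
        also have "\<dots> = (\<Sum>S\<in>I. (E (\<lambda>x. chi S x * of_bool (x \<notin> B)))\<^sup>2)"
          unfolding p_def expectation_density_pmf[OF \<phi>] fourier_coeff_chi by (simp add: mult_ac)
        finally show "w \<le> (\<Sum>S\<in>I. (E (\<lambda>x. chi S x * of_bool (x \<notin> B)))\<^sup>2)" .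
      qed
      hence "P ^ 20 \<le> (17 / 18) ^ 20" using P01 by (intro power_mono)
      \<comment> \<open>Here the number 20 is decided: the 19th power of 17/18 still exceeds
        1/3.\<close>
      also have "\<dots> \<le> (1 / 3 :: real)" by (simp add: power_divide)
      finally show "2 / 3 \<le> pmf (output_pmf n M A \<phi>) False" unfolding F by simp
    }
  qed
  with bound show ?thesis by blast
qed

section \<open>Deducing the two claims\<close>

text \<open>On two points every density is within total variation distance 1/2 of the uniform one.
  This settles the corner \<open>n = 1\<close> with \<delta> close to 1, where the logarithm in the
  first sample bound tends to 0 and no fixed number of samples would fit.\<close>

lemma not_far_singleton_cube:
  assumes \<phi>: "is_density 1 \<phi>" and \<delta>: "\<delta> \<ge> 1 / 2"
  shows "\<not> far_from_wise_uniform 1 \<delta> j \<phi>"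
proof -
  have "is_density 1 (\<lambda>_. 1)" by (simp add: is_density_def)
  moreover have "wise_uniform 1 j (\<lambda>_. 1)"
    by (auto simp: wise_uniform_def fourier_coeff_chi unif_expect_chi)
  moreover have "tv_dist 1 \<phi> (\<lambda>_. 1) \<le> 1 / 2"
  proof -
    define x0 :: point where "x0 = (\<lambda>_. undefined)"
    have "cube 0 = {x0}" by (simp add: x0_def cube_0)
    hence U: "unif_expect 1 f = (f (x0(0 := 1)) + f (x0(0 := -1))) / 2" for f
      unfolding One_nat_def by (simp add: unif_expect_sum sum_cube_Suc)
    have "\<phi> (x0(0 := 1)) \<ge> 0" "\<phi> (x0(0 := -1)) \<ge> 0"
      using \<phi> by (auto simp: is_density_def x0_def cube_def PiE_iff extensional_def)
    moreover have "\<phi> (x0(0 := 1)) + \<phi> (x0(0 := -1)) = 2"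
      using \<phi> unfolding is_density_def U by simp
    ultimately have "\<bar>\<phi> (x0(0 := 1)) - 1\<bar> \<le> 1" "\<bar>\<phi> (x0(0 := -1)) - 1\<bar> \<le> 1" by linarith+
    thus ?thesis unfolding tv_dist_def U by simp
  qed
  ultimately show ?thesis using \<delta> by (fastforce simp: far_from_wise_uniform_def)
qed

theorem theorem5:
  "(\<exists>C>0::real. \<forall>k::nat. k \<ge> 1 \<longrightarrow>
      (\<exists>(m :: nat \<Rightarrow> real \<Rightarrow> nat) (A :: nat \<Rightarrow> real \<Rightarrow> tester).
         \<forall>(n::nat) (\<delta>::real). n \<ge> 1 \<and> 0 < \<delta> \<and> \<delta> < 1 \<longrightarrow>
           real (m n \<delta>) \<le> (C * real k) ^ k * real n powr (real k / 2) * (1 / \<delta>\<^sup>2)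
                            * ln (real n / \<delta>) powr (real k / 2) \<and>
           tests n (m n \<delta>) (A n \<delta>) (fully_uniform n) (far_from_wise_uniform n \<delta> (real k))))
   \<and>
   (\<exists>C>0::real. \<forall>(\<alpha>::real) (k::nat). \<alpha> > 4 \<and> k \<ge> 1 \<longrightarrow>
      (\<exists>(m :: nat \<Rightarrow> real \<Rightarrow> nat) (A :: nat \<Rightarrow> real \<Rightarrow> tester).
         \<forall>(n::nat) (\<delta>::real). n \<ge> 1 \<and> 0 < \<delta> \<and> \<delta> < 1 \<longrightarrow>
           real (m n \<delta>) \<le> (C * \<alpha>) powr (real k / 2) * real n powr (real k / 2) * (1 / \<delta>\<^sup>2)
                            * (real n ^ k / \<delta> ^ 4) powr (1 / (\<alpha> - 2)) \<and>
           tests n (m n \<delta>) (A n \<delta>) (wise_uniform n (\<alpha> * real k))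
                 (far_from_wise_uniform n \<delta> (real k))))"
proof -
  define C0 :: real where "C0 = 14929920000"
  have C0: "C0 > 0" by (simp add: C0_def)
  have "\<forall>k n \<delta>. \<exists>M A. k \<ge> 1 \<and> n \<ge> 1 \<and> 0 < \<delta> \<and> \<delta> < 1 \<longrightarrow>
      real M \<le> C0 ^ k * real n powr (real k / 2) * (1 / \<delta>\<^sup>2) \<and>
      tests n M A (wise_uniform n (4 * real k)) (far_from_wise_uniform n \<delta> (real k))"
    unfolding C0_def using uniformity_tester by blast
  then obtain M A where MA: "\<And>k n \<delta>. k \<ge> 1 \<Longrightarrow> n \<ge> 1 \<Longrightarrow> 0 < \<delta> \<Longrightarrow> \<delta> < 1 \<Longrightarrow>
      real (M k n \<delta>) \<le> C0 ^ k * real n powr (real k / 2) * (1 / \<delta>\<^sup>2) \<and>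
      tests n (M k n \<delta>) (A k n \<delta>) (wise_uniform n (4 * real k)) (far_from_wise_uniform n \<delta> (real k))"
    by metis
  have full: "wise_uniform n j \<phi>" if "fully_uniform n \<phi>" for n j \<phi>
    unfolding wise_uniform_def
  proof (intro allI impI)
    fix S assume S: "S \<subseteq> {..<n} \<and> 1 \<le> card S \<and> real (card S) \<le> j"
    have "fourier_coeff n \<phi> S = unif_expect n (chi S)"
      unfolding fourier_coeff_chi using that by (intro unif_expect_cong) (simp add: fully_uniform_def)
    thus "fourier_coeff n \<phi> S = 0" using S by (auto simp: unif_expect_chi)
  qed
  show ?thesis
  proof (intro conjI)
    show "\<exists>C>0::real. \<forall>k::nat. k \<ge> 1 \<longrightarrow>
      (\<exists>(m :: nat \<Rightarrow> real \<Rightarrow> nat) (A :: nat \<Rightarrow> real \<Rightarrow> tester).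
         \<forall>(n::nat) (\<delta>::real). n \<ge> 1 \<and> 0 < \<delta> \<and> \<delta> < 1 \<longrightarrow>
           real (m n \<delta>) \<le> (C * real k) ^ k * real n powr (real k / 2) * (1 / \<delta>\<^sup>2)
                            * ln (real n / \<delta>) powr (real k / 2) \<and>
           tests n (m n \<delta>) (A n \<delta>) (fully_uniform n) (far_from_wise_uniform n \<delta> (real k)))"
    proof (rule exI[of _ "2 * C0"], intro conjI allI impI)
      fix k :: nat assume k: "k \<ge> 1"
      \<comment> \<open>In this corner nothing is far, so accepting without any samples is correct;
        outside it \<open>n / \<delta>\<close> is at least 2.\<close>
      define triv where "triv n \<delta> \<longleftrightarrow> n = 1 \<and> \<delta> \<ge> 1 / 2" for n :: nat and \<delta> :: real
      show "\<exists>(m :: nat \<Rightarrow> real \<Rightarrow> nat) (A :: nat \<Rightarrow> real \<Rightarrow> tester).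
         \<forall>(n::nat) (\<delta>::real). n \<ge> 1 \<and> 0 < \<delta> \<and> \<delta> < 1 \<longrightarrow>
           real (m n \<delta>) \<le> (2 * C0 * real k) ^ k * real n powr (real k / 2) * (1 / \<delta>\<^sup>2)
                            * ln (real n / \<delta>) powr (real k / 2) \<and>
           tests n (m n \<delta>) (A n \<delta>) (fully_uniform n) (far_from_wise_uniform n \<delta> (real k))"
      proof (rule exI[of _ "\<lambda>n \<delta>. if triv n \<delta> then 0 else M k n \<delta>"],
             rule exI[of _ "\<lambda>n \<delta>. if triv n \<delta> then (\<lambda>_. return_pmf True) else A k n \<delta>"], intro allI impI)
        fix n :: nat and \<delta> :: real assume n\<delta>: "n \<ge> 1 \<and> 0 < \<delta> \<and> \<delta> < 1"
        show "real (if triv n \<delta> then 0 else M k n \<delta>) \<le> (2 * C0 * real k) ^ k * real n powr (real k / 2) * (1 / \<delta>\<^sup>2)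
                            * ln (real n / \<delta>) powr (real k / 2) \<and>
           tests n (if triv n \<delta> then 0 else M k n \<delta>) (if triv n \<delta> then (\<lambda>_. return_pmf True) else A k n \<delta>)
             (fully_uniform n) (far_from_wise_uniform n \<delta> (real k))"
        proof (cases "triv n \<delta>")
          case True
          hence "tests n 0 (\<lambda>_. return_pmf True) (fully_uniform n) (far_from_wise_uniform n \<delta> (real k))"
            using not_far_singleton_cube by (auto simp: tests_def triv_def output_pmf_def)
          thus ?thesis using True C0 by simp
        next
          case False
          note MA' = MA[OF k, of n \<delta>]
          have "2 * \<delta> \<le> real n"
          proof (cases "n = 1")
            case True thus ?thesis using False n\<delta> by (simp add: triv_def)
          next
            case False
            hence "real n \<ge> 2" using n\<delta> by simp
            thus ?thesis using n\<delta> by linarith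
          qed
          hence "2 \<le> real n / \<delta>" using n\<delta> by (simp add: field_simps)
          hence "ln 2 \<le> ln (real n / \<delta>)" by (subst ln_le_cancel_iff) auto
          \<comment> \<open>The logarithm is at least 1/4, whose power \<open>k / 2\<close> is
            exactly \<open>(1 / 2) ^ k\<close>; the 2 in \<open>2 * C0\<close> makes up for this
            factor.\<close>
          hence L: "1 / 4 \<le> ln (real n / \<delta>)" using ln2_ge_two_thirds by linarith
          have "(1 / 2) ^ k = sqrt ((1 / 4) ^ k)"
            by (simp add: real_sqrt_power real_sqrt_divide)
          also have "\<dots> = (1 / 4) powr (real k / 2)" by (rule sqrt_power_eq_powr) simp
          also have "\<dots> \<le> ln (real n / \<delta>) powr (real k / 2)" using L by (intro powr_mono2) auto
          finally have half: "(1 / 2) ^ k \<le> ln (real n / \<delta>) powr (real k / 2)" .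
          let ?Y = "real n powr (real k / 2) * (1 / \<delta>\<^sup>2)"
          have "C0 ^ k \<le> (C0 * real k) ^ k" using C0 k by (intro power_mono) auto
          also have "\<dots> = (2 * C0 * real k) ^ k * (1 / 2) ^ k" by (simp flip: power_mult_distrib)
          also have "\<dots> \<le> (2 * C0 * real k) ^ k * ln (real n / \<delta>) powr (real k / 2)"
            using half C0 by (intro mult_left_mono) auto
          finally have "C0 ^ k * ?Y \<le> (2 * C0 * real k) ^ k * ln (real n / \<delta>) powr (real k / 2) * ?Y"
            by (intro mult_right_mono) auto
          hence "real (M k n \<delta>) \<le> (2 * C0 * real k) ^ k * ln (real n / \<delta>) powr (real k / 2) * ?Y"
            using MA' n\<delta> by (simp add: mult.assoc)
          moreover have "tests n (M k n \<delta>) (A k n \<delta>) (fully_uniform n) (far_from_wise_uniform n \<delta> (real k))"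
          proof (rule tests_mono)
            show "tests n (M k n \<delta>) (A k n \<delta>) (wise_uniform n (4 * real k)) (far_from_wise_uniform n \<delta> (real k))"
              using MA' n\<delta> by blast
          qed (rule full)
          ultimately show ?thesis using False by (simp add: mult_ac)
        qed
      qed
    qed (use C0 in simp)
  next
    show "\<exists>C>0::real. \<forall>(\<alpha>::real) (k::nat). \<alpha> > 4 \<and> k \<ge> 1 \<longrightarrow>
      (\<exists>(m :: nat \<Rightarrow> real \<Rightarrow> nat) (A :: nat \<Rightarrow> real \<Rightarrow> tester).
         \<forall>(n::nat) (\<delta>::real). n \<ge> 1 \<and> 0 < \<delta> \<and> \<delta> < 1 \<longrightarrow>
           real (m n \<delta>) \<le> (C * \<alpha>) powr (real k / 2) * real n powr (real k / 2) * (1 / \<delta>\<^sup>2)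
                            * (real n ^ k / \<delta> ^ 4) powr (1 / (\<alpha> - 2)) \<and>
           tests n (m n \<delta>) (A n \<delta>) (wise_uniform n (\<alpha> * real k))
                 (far_from_wise_uniform n \<delta> (real k)))"
    \<comment> \<open>The constant is squared because the claimed bound raises it only to the power
      \<open>k / 2\<close>.\<close>
    proof (rule exI[of _ "C0\<^sup>2"], intro conjI allI impI)
      fix \<alpha> :: real and k :: nat assume \<alpha>k: "\<alpha> > 4 \<and> k \<ge> 1"
      show "\<exists>(m :: nat \<Rightarrow> real \<Rightarrow> nat) (A :: nat \<Rightarrow> real \<Rightarrow> tester).
         \<forall>(n::nat) (\<delta>::real). n \<ge> 1 \<and> 0 < \<delta> \<and> \<delta> < 1 \<longrightarrow>
           real (m n \<delta>) \<le> (C0\<^sup>2 * \<alpha>) powr (real k / 2) * real n powr (real k / 2) * (1 / \<delta>\<^sup>2)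
                            * (real n ^ k / \<delta> ^ 4) powr (1 / (\<alpha> - 2)) \<and>
           tests n (m n \<delta>) (A n \<delta>) (wise_uniform n (\<alpha> * real k))
                 (far_from_wise_uniform n \<delta> (real k))"
      proof (rule exI[of _ "M k"], rule exI[of _ "A k"], intro allI impI)
        fix n :: nat and \<delta> :: real assume n\<delta>: "n \<ge> 1 \<and> 0 < \<delta> \<and> \<delta> < 1"
        note MA' = MA[of k n \<delta>]
        have "C0 ^ k = sqrt ((C0\<^sup>2) ^ k)" using C0 by (simp add: real_sqrt_power)
        also have "\<dots> = (C0\<^sup>2) powr (real k / 2)" using C0 by (intro sqrt_power_eq_powr) simp
        also have "\<dots> \<le> (C0\<^sup>2 * \<alpha>) powr (real k / 2)"
          using \<alpha>k C0 by (intro powr_mono2) (auto simp: mult_le_cancel_left1)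
        finally have c: "C0 ^ k \<le> (C0\<^sup>2 * \<alpha>) powr (real k / 2)" .
        \<comment> \<open>The base of the last factor is at least 1 and its exponent is positive, so
          this factor can only enlarge the bound.\<close>
        have "1 * \<delta> ^ 4 \<le> real n ^ k"
          using n\<delta> by (intro order_trans[OF _ one_le_power]) (auto intro: power_le_one)
        hence "1 \<le> real n ^ k / \<delta> ^ 4" using n\<delta> by (simp add: field_simps)
        hence r: "1 \<le> (real n ^ k / \<delta> ^ 4) powr (1 / (\<alpha> - 2))"
          using \<alpha>k by (intro ge_one_powr_ge_zero) auto
        have "real (M k n \<delta>) \<le> C0 ^ k * real n powr (real k / 2) * (1 / \<delta>\<^sup>2) * 1"
          using MA' n\<delta> \<alpha>k by simp
        also have "\<dots> \<le> (C0\<^sup>2 * \<alpha>) powr (real k / 2) * real n powr (real k / 2) * (1 / \<delta>\<^sup>2)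
                            * (real n ^ k / \<delta> ^ 4) powr (1 / (\<alpha> - 2))"
          by (intro mult_mono c r order_refl mult_nonneg_nonneg) auto
        finally have "real (M k n \<delta>) \<le> (C0\<^sup>2 * \<alpha>) powr (real k / 2) * real n powr (real k / 2) * (1 / \<delta>\<^sup>2)
                            * (real n ^ k / \<delta> ^ 4) powr (1 / (\<alpha> - 2))" .
        moreover have "tests n (M k n \<delta>) (A k n \<delta>) (wise_uniform n (\<alpha> * real k)) (far_from_wise_uniform n \<delta> (real k))"
        proof (rule tests_mono[of _ _ _ "wise_uniform n (4 * real k)"])
          fix \<phi> assume "wise_uniform n (\<alpha> * real k) \<phi>"
          moreover have "4 * real k \<le> \<alpha> * real k" using \<alpha>k by (intro mult_right_mono) auto
          ultimately show "wise_uniform n (4 * real k) \<phi>" by (auto simp: wise_uniform_def)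
        qed (use MA' n\<delta> \<alpha>k in blast)
        ultimately show "real (M k n \<delta>) \<le> (C0\<^sup>2 * \<alpha>) powr (real k / 2) * real n powr (real k / 2) * (1 / \<delta>\<^sup>2)
                            * (real n ^ k / \<delta> ^ 4) powr (1 / (\<alpha> - 2)) \<and>
           tests n (M k n \<delta>) (A k n \<delta>) (wise_uniform n (\<alpha> * real k)) (far_from_wise_uniform n \<delta> (real k))" ..
      qed
    qed (use C0 in simp)
  qed
qed

end
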